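(* An abelian surface $X$ with Picard number $\rho(X)$ admits a mirror partner if and only if (1) $\rho(X)\leq 2$, or (2) $\rho(X)=3$ and $\mathrm{NS}(X)\cong\mathbb{Z}(-2n)\oplus U$ for some positive integer $n$.
   Context: Abelian surfaces are over $\mathbb{C}$. $U$ is the rank-$2$ lattice with Gram matrix $\begin{pmatrix}0&1\\1&0\end{pmatrix}$, and $\mathbb{Z}(m)$ is the rank-one lattice with a generator of square $m$. For an abelian surface $X$, $\mathrm{NS}(X)\subseteq H^2(X,\mathbb{Z})$ is the N\'eron--Severi lattice and $T(X)=\mathrm{NS}(X)^\perp\subseteq H^2(X,\mathbb{Z})$. $N(X)=H^0(X,\mathbb{Z})\oplus\mathrm{NS}(X)\oplus H^4(X,\mathbb{Z})$ carries the Mukai pairing $(r,D,s)\cdot(r',D',s')=DD'-rs'-sr'$, so $N(X)\cong\mathrm{NS}(X)\oplus U$. Two abelian surfaces $X$ and $Y$ are mirror partners if there exist lattice isometries $T(X)\cong N(Y)$ and $N(X)\cong T(Y)$. *)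

theory Defs
  imports "HOL-Analysis.Analysis"
begin

section \<open>Lattices\<close>

text \<open>An integral lattice: an additive subgroup of the ambient type together with an
  integer-valued pairing.  The pairing is only meaningful on the carrier.\<close>

record 'a zlattice =
  elts :: "'a set"
  pairing :: "'a \<Rightarrow> 'a \<Rightarrow> int"

definition lattice_isometry ::
    "('a::ab_group_add) zlattice \<Rightarrow> ('b::ab_group_add) zlattice \<Rightarrow> ('a \<Rightarrow> 'b) \<Rightarrow> bool" where
  "lattice_isometry L M f \<longleftrightarrow>
     bij_betw f (elts L) (elts M) \<and>
     (\<forall>x\<in>elts L. \<forall>y\<in>elts L. f (x + y) = f x + f y) \<and>
     (\<forall>x\<in>elts L. \<forall>y\<in>elts L. pairing M (f x) (f y) = pairing L x y)"

definition isometric ::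
    "('a::ab_group_add) zlattice \<Rightarrow> ('b::ab_group_add) zlattice \<Rightarrow> bool" where
  "isometric L M \<longleftrightarrow> (\<exists>f. lattice_isometry L M f)"

definition orth_sum :: "'a zlattice \<Rightarrow> 'b zlattice \<Rightarrow> ('a \<times> 'b) zlattice" where
  "orth_sum L M = \<lparr>elts = elts L \<times> elts M,
     pairing = (\<lambda>(x, y) (x', y'). pairing L x x' + pairing M y y')\<rparr>"

definition U_lattice :: "(int \<times> int) zlattice" where
  "U_lattice = \<lparr>elts = UNIV, pairing = (\<lambda>(a, b) (a', b'). a * b' + b * a')\<rparr>"

definition Z_lattice :: "int \<Rightarrow> int zlattice" where
  "Z_lattice m = \<lparr>elts = UNIV, pairing = (\<lambda>a b. m * a * b)\<rparr>"

definition zscale :: "int \<Rightarrow> 'a::real_vector \<Rightarrow> 'a" where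
  "zscale k x = of_int k *\<^sub>R x"

interpretation zmod: module "zscale :: int \<Rightarrow> 'a::real_vector \<Rightarrow> 'a"
  by unfold_locales (simp_all add: zscale_def scaleR_add_right scaleR_add_left)

text \<open>The rank of an abelian group, as the largest size of a linearly independent set
  over the integers.\<close>

definition zrank :: "'a::real_vector set \<Rightarrow> nat" where
  "zrank A = (GREATEST n. \<exists>B\<subseteq>A. finite B \<and> zmod.independent B \<and> card B = n)"

section \<open>Two-dimensional complex tori\<close>

text \<open>The torus \<open>\<complex>\<^sup>2 / \<Lambda>\<close> is represented by its period lattice \<open>\<Lambda>\<close>, the subgroup generated
  by an \<open>\<real>\<close>-basis of \<open>\<complex>\<^sup>2\<close>.\<close>

definition period_lattice :: "(complex ^ 2) set \<Rightarrow> bool" where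
  "period_lattice \<Lambda> \<longleftrightarrow>
     (\<exists>B. independent B \<and> span B = (UNIV :: (complex ^ 2) set) \<and> zmod.span B = \<Lambda>)"

text \<open>Real bilinear forms on \<open>\<complex>\<^sup>2\<close>; boundedness is automatic in finite dimension.\<close>

type_synonym form = "(complex ^ 2) \<Rightarrow>\<^sub>L (complex ^ 2) \<Rightarrow>\<^sub>L real"

abbreviation ev :: "form \<Rightarrow> complex ^ 2 \<Rightarrow> complex ^ 2 \<Rightarrow> real" where
  "ev E x y \<equiv> blinfun_apply (blinfun_apply E x) y"

text \<open>\<open>H\<^sup>2(X, \<int>)\<close> is the group of integer-valued alternating forms on \<open>\<Lambda> = H\<^sub>1(X, \<int>)\<close>.  Such a
  form is identified with its unique \<open>\<real>\<close>-bilinear extension to \<open>\<complex>\<^sup>2\<close>, that is, with a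
  translation-invariant real 2-form with integral periods.\<close>

definition H2 :: "(complex ^ 2) set \<Rightarrow> form set" where
  "H2 \<Lambda> = {E. (\<forall>x. ev E x x = 0) \<and> (\<forall>x\<in>\<Lambda>. \<forall>y\<in>\<Lambda>. ev E x y \<in> \<int>)}"

definition wedge ::
    "form \<Rightarrow> form \<Rightarrow> complex ^ 2 \<Rightarrow> complex ^ 2 \<Rightarrow> complex ^ 2 \<Rightarrow> complex ^ 2 \<Rightarrow> real" where
  "wedge E F v\<^sub>1 v\<^sub>2 v\<^sub>3 v\<^sub>4 =
     ev E v\<^sub>1 v\<^sub>2 * ev F v\<^sub>3 v\<^sub>4 - ev E v\<^sub>1 v\<^sub>3 * ev F v\<^sub>2 v\<^sub>4 + ev E v\<^sub>1 v\<^sub>4 * ev F v\<^sub>2 v\<^sub>3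
   + ev E v\<^sub>2 v\<^sub>3 * ev F v\<^sub>1 v\<^sub>4 - ev E v\<^sub>2 v\<^sub>4 * ev F v\<^sub>1 v\<^sub>3 + ev E v\<^sub>3 v\<^sub>4 * ev F v\<^sub>1 v\<^sub>2"

text \<open>Coordinates in the \<open>\<real>\<close>-basis \<open>e\<^sub>1, \<i>e\<^sub>1, e\<^sub>2, \<i>e\<^sub>2\<close>, which is positive for the
  complex orientation.\<close>

definition real_coords :: "complex ^ 2 \<Rightarrow> real ^ 4" where
  "real_coords z = vector [Re (z $ 1), Im (z $ 1), Re (z $ 2), Im (z $ 2)]"

definition oriented_basis :: "(complex ^ 2) set \<Rightarrow> (complex ^ 2) ^ 4 \<Rightarrow> bool" where
  "oriented_basis \<Lambda> b \<longleftrightarrow>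
     det (\<chi> i. real_coords (b $ i)) > 0 \<and> zmod.span (range (\<lambda>i. b $ i)) = \<Lambda>"

text \<open>The intersection form is the cup product followed by evaluation on the fundamental
  class, hence \<open>E \<and> F\<close> evaluated on a positively oriented \<open>\<int>\<close>-basis of \<open>\<Lambda>\<close>.  For \<open>E\<close> and \<open>F\<close> in
  \<open>H2 \<Lambda>\<close> the value is an integer that does not depend on the basis.\<close>

definition cup :: "(complex ^ 2) set \<Rightarrow> form \<Rightarrow> form \<Rightarrow> int" where
  "cup \<Lambda> E F = (THE n. \<exists>b. oriented_basis \<Lambda> b \<and>
     of_int n = wedge E F (b $ 1) (b $ 2) (b $ 3) (b $ 4))"

text \<open>The Neron-Severi lattice consists of the integral classes of Hodge type \<open>(1,1)\<close>: a
  real alternating form has type \<open>(1,1)\<close> iff it is invariant under multiplication by \<open>\<i>\<close>,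
  i.e. iff it is the imaginary part of a Hermitian form.\<close>

definition NS :: "(complex ^ 2) set \<Rightarrow> form zlattice" where
  "NS \<Lambda> = \<lparr>elts = {E \<in> H2 \<Lambda>. \<forall>x y. ev E (\<i> *s x) (\<i> *s y) = ev E x y}, pairing = cup \<Lambda>\<rparr>"

definition picard_number :: "(complex ^ 2) set \<Rightarrow> nat" where
  "picard_number \<Lambda> = zrank (elts (NS \<Lambda>))"

definition T_lattice :: "(complex ^ 2) set \<Rightarrow> form zlattice" where
  "T_lattice \<Lambda> =
     \<lparr>elts = {E \<in> H2 \<Lambda>. \<forall>D\<in>elts (NS \<Lambda>). cup \<Lambda> E D = 0}, pairing = cup \<Lambda>\<rparr>"

text \<open>The components of a triple are \<open>(r, D, s) \<in> H\<^sup>0 \<oplus> NS \<oplus> H\<^sup>4\<close>; the pairing is the Mukai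
  pairing.\<close>

definition N_lattice :: "(complex ^ 2) set \<Rightarrow> (int \<times> form \<times> int) zlattice" where
  "N_lattice \<Lambda> = \<lparr>elts = UNIV \<times> elts (NS \<Lambda>) \<times> UNIV,
     pairing = (\<lambda>(r, D, s) (r', D', s'). cup \<Lambda> D D' - r * s' - s * r')\<rparr>"

section \<open>Abelian surfaces and mirror partners\<close>

text \<open>A polarization is the first Chern class of a positive line bundle, i.e. the imaginary
  part \<open>E\<close> of a positive definite Hermitian form \<open>H(x, y) = E(\<i>x, y) + \<i>E(x, y)\<close> that is
  integral on \<open>\<Lambda>\<close>.  A complex torus is an abelian variety iff it has a polarization.\<close>

definition polarization :: "(complex ^ 2) set \<Rightarrow> form \<Rightarrow> bool" where
  "polarization \<Lambda> E \<longleftrightarrow> E \<in> elts (NS \<Lambda>) \<and> (\<forall>x. x \<noteq> 0 \<longrightarrow> ev E (\<i> *s x) x > 0)"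

definition abelian_surface :: "(complex ^ 2) set \<Rightarrow> bool" where
  "abelian_surface \<Lambda> \<longleftrightarrow> period_lattice \<Lambda> \<and> (\<exists>E. polarization \<Lambda> E)"

definition mirror_partners :: "(complex ^ 2) set \<Rightarrow> (complex ^ 2) set \<Rightarrow> bool" where
  "mirror_partners X Y \<longleftrightarrow>
     isometric (T_lattice X) (N_lattice Y) \<and> isometric (N_lattice X) (T_lattice Y)"

end

theory Submission
  imports Defs
begin

text \<open>On the lattice side, \<open>H\<^sup>2(X, \<int>)\<close> is \<open>U \<oplus> U \<oplus> U\<close>.  Since \<open>U \<oplus> U\<close> is the lattice of integral
  \<open>2 \<times> 2\<close> matrices with twice the determinant as quadratic form, the Smith normal form gives enough
  isometries to move \<open>NS(X)\<close> into the last two summands \<open>U \<oplus> U\<close> if its rank is at most 2, or if it is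
  \<open>\<int>(-2n) \<oplus> U\<close>.  If \<open>K\<close> is the orthogonal complement of \<open>NS(X)\<close> in \<open>U \<oplus> U\<close>, then \<open>T(X) = U \<oplus> K\<close>.
  A mirror partner must therefore satisfy \<open>NS(Y) = K\<close>; such a torus is \<open>\<complex>\<^sup>2 / (\<int>\<^sup>2 + \<i> W \<int>\<^sup>2)\<close> with the real
  matrix \<open>W\<close> a generic point of the real span of \<open>NS(X)\<close>, regarded as a space of matrices (the tube
  domain description of the periods).  By the Hodge index theorem \<open>K\<close> contains a vector of positive
  square, and that class is a polarization up to sign.

  Conversely, \<open>T(X) \<cong> N(Y)\<close> contains a copy of \<open>U\<close> and, orthogonally to it, a polarization of \<open>Y\<close>.
  The orthogonal complement of these classes in \<open>H\<^sup>2(X, \<int>)\<close> is \<open>\<int>(-2n) \<oplus> U\<close>, again by the Smith normal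
  form.  It contains \<open>NS(X)\<close>, and equals it if \<open>NS(X)\<close> has rank 3, because \<open>NS(X)\<close> is saturated.\<close>

section \<open>Isometries of sums of hyperbolic planes\<close>

text \<open>Rank 2 is the limit for arbitrary lattices because each vector uses up one plane: one
  vector fits into a plane, and a second one then needs only one more plane. A third vector would in
  general need the third plane, so rank 3 requires the special shape. Writing NS(X) as a double
  orthogonal complement makes \<open>perp\<close> an involution on the lattices that occur, so that
  X and Y play symmetric roles. By signatures, \<open>K\<close> is of type (1, 3 - \<rho>) inside U
  + U of type (2, 2), which is why a positive class is available up to \<rho> = 3. In coordinates of
  H^2(Y) in U + U + U, the holomorphic 2-form dz1 dz2 of the torus is ((1, D), - i w), where w is
  the real vector encoded by W and D is half its square. A class has type (1,1) iff it is orthogonal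
  to the real and the imaginary part. Hence two genericity conditions are needed: D must be
  irrational, which removes the first plane, and the integral vectors orthogonal to w must be
  exactly those of \<open>K\<close>. Powers of one transcendental number achieve both.\<close>

definition U2 :: "((int \<times> int) \<times> (int \<times> int)) zlattice" where
  "U2 = orth_sum U_lattice U_lattice"

definition U3 :: "((int \<times> int) \<times> (int \<times> int) \<times> (int \<times> int)) zlattice" where
  "U3 = orth_sum U_lattice U2"

lemma elts_U [simp]: "elts U_lattice = UNIV"
  by (simp add: U_lattice_def)

lemma pairing_U [simp]: "pairing U_lattice (a, b) (a', b') = a * b' + b * a'"
  by (simp add: U_lattice_def)

lemma elts_orth_sum [simp]: "elts (orth_sum L M) = elts L \<times> elts M"
  by (simp add: orth_sum_def)

lemma pairing_orth_sum [simp]: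
  "pairing (orth_sum L M) (x, y) (x', y') = pairing L x x' + pairing M y y'"
  by (simp add: orth_sum_def)

lemma elts_U2 [simp]: "elts U2 = UNIV"
  by (simp add: U2_def)

lemma elts_U3 [simp]: "elts U3 = UNIV"
  by (simp add: U3_def)

lemma pairing_U2 [simp]:
  "pairing U2 ((c, d), (p, q)) ((c', d'), (p', q')) = c * d' + d * c' + (p * q' + q * p')"
  by (simp add: U2_def)

lemma pairing_U3 [simp]: "pairing U3 (u, x) (u', x') = pairing U_lattice u u' + pairing U2 x x'"
  by (simp add: U3_def)

lemma lattice_isometry_pairing:
  "lattice_isometry L M f \<Longrightarrow> x \<in> elts L \<Longrightarrow> y \<in> elts L \<Longrightarrow> pairing M (f x) (f y) = pairing L x y"
  by (simp add: lattice_isometry_def)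

lemma lattice_isometry_add:
  "lattice_isometry L M f \<Longrightarrow> x \<in> elts L \<Longrightarrow> y \<in> elts L \<Longrightarrow> f (x + y) = f x + f y"
  by (simp add: lattice_isometry_def)

lemma lattice_isometry_id: "lattice_isometry L L id"
  by (simp add: lattice_isometry_def)

lemma lattice_isometry_comp:
  assumes "lattice_isometry L M f" "lattice_isometry M N g"
  shows "lattice_isometry L N (g \<circ> f)"
proof -
  have "f x \<in> elts M" if "x \<in> elts L" for x
    using assms(1) that by (auto simp: lattice_isometry_def bij_betw_def)
  then show ?thesis
    using assms unfolding lattice_isometry_def by (auto intro: bij_betw_trans)
qed

text \<open>The type of lattices does not force a carrier to be closed under addition, and
  additivity of the inverse needs the sum of two preimages to lie in the carrier again; hence the
  second assumption, also in \<open>isometric_sym\<close>.\<close>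

lemma lattice_isometry_inv_into:
  assumes f: "lattice_isometry L M f"
    and add: "\<And>x y. x \<in> elts L \<Longrightarrow> y \<in> elts L \<Longrightarrow> x + y \<in> elts L"
  shows "lattice_isometry M L (inv_into (elts L) f)"
proof -
  let ?g = "inv_into (elts L) f"
  have bij: "bij_betw f (elts L) (elts M)"
    using f by (simp add: lattice_isometry_def)
  have g: "?g x \<in> elts L" "f (?g x) = x" if "x \<in> elts M" for x
    using bij that by (auto simp: bij_betw_def inv_into_into f_inv_into_f)
  have "?g (x + y) = ?g x + ?g y" if "x \<in> elts M" "y \<in> elts M" for x y
  proof -
    have "f (?g x + ?g y) = x + y"
      using f g that by (simp add: lattice_isometry_def)
    then show ?thesis
      using bij add g that by (metis bij_betw_imp_inj_on inv_into_f_f)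
  qed
  moreover have "pairing L (?g x) (?g y) = pairing M x y" if "x \<in> elts M" "y \<in> elts M" for x y
    using f g that unfolding lattice_isometry_def by metis
  ultimately show ?thesis
    using bij_betw_inv_into[OF bij] by (simp add: lattice_isometry_def)
qed

lemma isometric_trans: "isometric L M \<Longrightarrow> isometric M N \<Longrightarrow> isometric L N"
  unfolding isometric_def using lattice_isometry_comp by blast

lemma isometric_sym:
  assumes "isometric L M" "\<And>x y. x \<in> elts L \<Longrightarrow> y \<in> elts L \<Longrightarrow> x + y \<in> elts L"
  shows "isometric M L"
  using assms lattice_isometry_inv_into unfolding isometric_def by blast

lemma lattice_isometry_orth_sum:
  assumes "lattice_isometry L L' f" "lattice_isometry M M' g"
  shows "lattice_isometry (orth_sum L M) (orth_sum L' M') (map_prod f g)"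
  using assms unfolding lattice_isometry_def by (auto intro: bij_betw_map_prod)

lemma lattice_isometryI:
  assumes "elts L = UNIV" "elts M = UNIV" "\<And>x. g (f x) = x" "\<And>x. f (g x) = x"
    "\<And>x y. f (x + y) = f x + f y" "\<And>x y. pairing M (f x) (f y) = pairing L x y"
  shows "lattice_isometry L M f"
  using assms unfolding lattice_isometry_def
  by (auto intro: bij_betw_byWitness[where f' = g])

lemma lattice_isometry_cycle:
  "lattice_isometry U3 U3 (\<lambda>(x, y, z). (z, x, y))"
  by (rule lattice_isometryI[where g = "\<lambda>(z, x, y). (x, y, z)"]) auto

text \<open>Conjugation of \<open>map_prod id f\<close> by the cyclic permutation of the planes; the
  cycle has order three, so two more cycles undo the first.\<close>

lemma lattice_isometry_first_two:
  assumes "lattice_isometry U2 U2 f"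
  shows "lattice_isometry U3 U3 (\<lambda>(x, y, z). let (x', y') = f (x, y) in (x', y', z))"
proof -
  define c where "c = (\<lambda>(x, y, z). (z, x, y :: int \<times> int) :: (int \<times> int) \<times> (int \<times> int) \<times> (int \<times> int))"
  have c: "lattice_isometry U3 U3 c"
    unfolding c_def by (rule lattice_isometry_cycle)
  have m: "lattice_isometry U3 U3 (map_prod id f)"
    unfolding U3_def by (intro lattice_isometry_orth_sum lattice_isometry_id assms)
  have "lattice_isometry U3 U3 (c \<circ> (c \<circ> (map_prod id f \<circ> c)))"
    by (rule lattice_isometry_comp[OF lattice_isometry_comp[OF lattice_isometry_comp[OF c m] c] c])
  moreover have "c \<circ> (c \<circ> (map_prod id f \<circ> c)) = (\<lambda>(x, y, z). let (x', y') = f (x, y) in (x', y', z))"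
    by (auto simp: c_def fun_eq_iff Let_def split: prod.splits)
  ultimately show ?thesis by simp
qed

section \<open>Orbits of vectors and the Smith normal form\<close>

definition moves :: "('a::ab_group_add) zlattice \<Rightarrow> 'a \<Rightarrow> 'a \<Rightarrow> bool" where
  "moves L x y \<longleftrightarrow> (\<exists>f. lattice_isometry L L f \<and> f x = y)"

lemma moves_trans [trans]: "moves L x y \<Longrightarrow> moves L y z \<Longrightarrow> moves L x z"
  unfolding moves_def using lattice_isometry_comp by fastforce

lemma moves_U2_swap: "moves U2 (x, y) (y, x)"
  unfolding moves_def
  by (rule exI[where x = "\<lambda>(x, y). (y, x)"], rule conjI, rule lattice_isometryI[where g = "\<lambda>(x, y). (y, x)"]) auto

lemma moves_U2_swap_snd: "moves U2 (x, (p, q)) (x, (q, p))"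
  unfolding moves_def
  by (rule exI[where x = "\<lambda>(x, (p, q)). (x, (q, p))"], rule conjI,
      rule lattice_isometryI[where g = "\<lambda>(x, (p, q)). (x, (q, p))"]) auto

text \<open>For the matrix with rows \<open>(c, - p)\<close> and \<open>(q, d)\<close> this adds
  \<open>k\<close> times the first column to the second. Together with the swaps it provides the
  Euclidean algorithm on the entries.\<close>

lemma moves_U2_row:
  "moves U2 ((c, d), (p, q)) ((c, d + k * q), (p - k * c, q))"
  unfolding moves_def
  by (rule exI[where x = "\<lambda>((c, d), (p, q)). ((c, d + k * q), (p - k * c, q))"], rule conjI,
      rule lattice_isometryI[where g = "\<lambda>((c, d), (p, q)). ((c, d - k * q), (p + k * c, q))"])
     (auto simp: algebra_simps)

lemma moves_U2_swap_fst: "moves U2 ((c, d), x) ((d, c), x)"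
  unfolding moves_def
  by (rule exI[where x = "\<lambda>((c, d), x). ((d, c), x)"], rule conjI,
      rule lattice_isometryI[where g = "\<lambda>((c, d), x). ((d, c), x)"]) auto

text \<open>Reading \<open>((c, d), (p, q))\<close> as the matrix with rows \<open>(c, -p)\<close> and \<open>(q, d)\<close>, whose determinant
  is half the square, this is the Smith normal form.\<close>

lemma Smith_U2:
  fixes x :: "(int \<times> int) \<times> (int \<times> int)"
  shows "\<exists>g h. moves U2 x ((g, h), (0, 0)) \<and> g dvd h"
proof (cases "x = 0")
  case True
  have "moves U2 x x"
    unfolding moves_def using lattice_isometry_id by fastforce
  then show ?thesis
    using True by (auto simp: zero_prod_def)
next
  case False
  \<comment> \<open>Minimality replaces an explicit Euclidean algorithm: a point of the orbit is
    chosen whose leading entry is nonzero and as small as possible in absolute value.\<close>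
  define P where "P y \<longleftrightarrow> moves U2 x y \<and> fst (fst y) \<noteq> 0" for y
  obtain c d p q where x: "x = ((c, d), (p, q))" by (metis surj_pair)
  have refl: "moves U2 x x"
    unfolding moves_def using lattice_isometry_id by fastforce
  have "\<exists>y. P y"
  proof -
    consider "c \<noteq> 0" | "d \<noteq> 0" | "p \<noteq> 0" | "q \<noteq> 0"
      using False x by (auto simp: zero_prod_def)
    then show ?thesis
    proof cases
      case 1 then show ?thesis using refl x by (auto simp: P_def)
    next
      case 2
      then have "P ((d, c), (p, q))" using moves_U2_swap_fst x by (auto simp: P_def)
      then show ?thesis by blast
    next
      case 3
      then have "P ((p, q), (c, d))" using moves_U2_swap x by (auto simp: P_def)
      then show ?thesis by blast
    next
      case 4
      have "moves U2 x ((q, p), (c, d))"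
        using moves_U2_swap_snd moves_U2_swap moves_trans x by metis
      then have "P ((q, p), (c, d))" using 4 by (auto simp: P_def)
      then show ?thesis by blast
    qed
  qed
  then obtain y where y: "P y" and min: "\<And>z. P z \<Longrightarrow> nat \<bar>fst (fst y)\<bar> \<le> nat \<bar>fst (fst z)\<bar>"
    using ex_has_least_nat[of P _ "\<lambda>y. nat \<bar>fst (fst y)\<bar>"] by blast
  obtain c d p q where y_eq: "y = ((c, d), (p, q))" by (metis surj_pair)
  have c: "c \<noteq> 0" using y y_eq by (simp add: P_def)
  \<comment> \<open>Otherwise a column operation would turn \<open>p'\<close> into
    \<open>p' mod c\<close>, and a swap would bring this smaller nonzero entry to the front.\<close>
  have dvd: "c dvd p'" if "moves U2 x ((c, d'), (p', q'))" for d' p' q'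
  proof -
    let ?k = "p' div c"
    have "moves U2 x ((c, d' + ?k * q'), (p' - ?k * c, q'))"
      using that moves_U2_row moves_trans by blast
    then have "moves U2 x ((p' - ?k * c, q'), (c, d' + ?k * q'))"
      using moves_U2_swap moves_trans by blast
    moreover have "p' - ?k * c = p' mod c"
      by (simp add: minus_div_mult_eq_mod)
    ultimately have m: "moves U2 x ((p' mod c, q'), (c, d' + ?k * q'))" by simp
    have "p' mod c = 0"
    proof (rule ccontr)
      assume "p' mod c \<noteq> 0"
      then have "P ((p' mod c, q'), (c, d' + ?k * q'))" using m by (simp add: P_def)
      then have "nat \<bar>c\<bar> \<le> nat \<bar>p' mod c\<bar>"
        using min y_eq by fastforce
      then show False using abs_mod_less[OF c, of p'] by linarith
    qed
    then show ?thesis by auto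
  qed
  have 1: "moves U2 x ((c, d), (p, q))" using y y_eq by (simp add: P_def)
  obtain k where k: "p = k * c" using dvd[OF 1] by (metis dvd_def mult.commute)
  have "moves U2 x ((c, d + k * q), (p - k * c, q))"
    using 1 moves_U2_row moves_trans by blast
  then have "moves U2 x ((c, d + k * q), (0, q))" using k by simp
  then have 2: "moves U2 x ((c, d + k * q), (q, 0))"
    using moves_U2_swap_snd moves_trans by blast
  obtain l where l: "q = l * c" using dvd[OF 2] by (metis dvd_def mult.commute)
  define e where "e = d + k * q"
  have "moves U2 x ((c, e + l * 0), (q - l * c, 0))"
    using 2 moves_U2_row moves_trans unfolding e_def by blast
  then have 3: "moves U2 x ((c, e), (0, 0))" using l by simp
  \<comment> \<open>The matrix is diagonal now. One more column operation puts \<open>- e\<close> in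
    an off-diagonal position, where \<open>dvd\<close> applies to it.\<close>
  then have "moves U2 x ((e, c), (0, 0))"
    using moves_U2_swap_fst moves_trans by blast
  then have "moves U2 x ((e, c + 1 * 0), (0 - 1 * e, 0))"
    using moves_U2_row moves_trans by blast
  then have "moves U2 x ((c, e), (- e, 0))"
    using moves_U2_swap_fst moves_trans by fastforce
  then have "c dvd e" using dvd by fastforce
  then show ?thesis using 3 by blast
qed

lemma moves_U3_snd: "moves U2 x y \<Longrightarrow> moves U3 (u, x) (u, y)"
  unfolding moves_def U3_def
  using lattice_isometry_orth_sum[OF lattice_isometry_id] by (metis id_apply map_prod_simp)

lemma moves_U3_fst: "moves U2 (u, v) (u', v') \<Longrightarrow> moves U3 (u, v, w) (u', v', w)"
  unfolding moves_def
  by (erule exE, rule exI, rule conjI, rule lattice_isometry_first_two) auto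

text \<open>Two Smith reductions: the one in the last two planes empties the third plane, the one in
  the first two planes then empties the second.\<close>

lemma Smith_U3: "\<exists>g h. moves U3 x ((g, h), (0, 0), (0, 0)) \<and> g dvd h"
proof -
  obtain u y where x: "x = (u, y)" by (metis surj_pair)
  obtain g h where gh: "moves U2 y ((g, h), (0, 0))" using Smith_U2 by blast
  obtain g' h' where gh': "moves U2 (u, (g, h)) ((g', h'), (0, 0))" "g' dvd h'"
    using Smith_U2 by blast
  have "moves U3 x (u, (g, h), (0, 0))"
    using moves_U3_snd[OF gh] x by simp
  also have "moves U3 \<dots> ((g', h'), (0, 0), (0, 0))"
    using moves_U3_fst[OF gh'(1)] .
  finally show ?thesis using gh'(2) by blast
qed

section \<open>Hyperbolic pairs and Eichler transvections\<close>

lemma lattice_isometry_uminus: "lattice_isometry U3 U3 uminus"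
  by (rule lattice_isometryI[where g = uminus]) auto

text \<open>This is the transvection attached to the isotropic vector e = ((1, 0), (0, 0), (0, 0))
  and to m = ((c, d), (p, q)) in the other two planes; \<open>c * d + p * q\<close> is half the
  square of m. It fixes e, and its inverse is the transvection for - m.\<close>

lemma lattice_isometry_Eichler_transvection:
  "lattice_isometry U3 U3
     (\<lambda>((a, b), (c', d'), (p', q')).
        ((a + (c * d' + d * c' + (p * q' + q * p')) - b * (c * d + p * q), b),
         (c' - b * c, d' - b * d), (p' - b * p, q' - b * q)))"
  by (rule lattice_isometryI[where g = "\<lambda>((a, b), (c', d'), (p', q')).
        ((a - (c * d' + d * c' + (p * q' + q * p')) - b * (c * d + p * q), b),
         (c' + b * c, d' + b * d), (p' + b * p, q' + b * q))"])
     (auto simp: algebra_simps)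

text \<open>In Smith form the isotropic vector \<open>e\<close> is ((g, 0), 0, 0), because
  \<open>g * h = 0\<close> and \<open>g dvd h\<close>; pairing with \<open>f\<close> forces g to be
  a unit. After a change of sign, the image of \<open>f\<close> is ((s, 1), m) with s minus half the
  square of m, and the transvection for m removes m and s without moving the image of
  \<open>e\<close>.\<close>

lemma hyperbolic_pair_standard:
  assumes ee: "pairing U3 e e = 0" and ff: "pairing U3 f f = 0" and ef: "pairing U3 e f = 1"
  obtains \<phi> where "lattice_isometry U3 U3 \<phi>"
    "\<phi> e = ((1, 0), (0, 0), (0, 0))" "\<phi> f = ((0, 1), (0, 0), (0, 0))"
proof -
  obtain g h \<psi> where \<psi>: "lattice_isometry U3 U3 \<psi>" "\<psi> e = ((g, h), (0, 0), (0, 0))" and gh: "g dvd h"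
    using Smith_U3[of e] unfolding moves_def by blast
  have inv: "pairing U3 (\<psi> x) (\<psi> y) = pairing U3 x y" for x y
    using lattice_isometry_pairing[OF \<psi>(1)] by simp
  have "g * h = 0" using inv[of e e] ee \<psi>(2) by simp
  then have h: "h = 0" using gh by auto
  obtain s t m where f: "\<psi> f = ((s, t), m)" by (metis surj_pair)
  have "g * t = 1"
    using inv[of e f] ef \<psi>(2) f h by (cases m) auto
  then consider "g = 1" | "g = - 1" by (metis zmult_eq_1_iff)
  then obtain \<eta> where \<eta>: "lattice_isometry U3 U3 \<eta>" "\<eta> e = ((1, 0), (0, 0), (0, 0))"
  proof cases
    case 1 then show ?thesis using \<psi> h that by simp
  next
    case 2
    then show ?thesis using \<psi> h that[of "uminus \<circ> \<psi>"]
        lattice_isometry_comp[OF \<psi>(1) lattice_isometry_uminus] by simp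
  qed
  have inv: "pairing U3 (\<eta> x) (\<eta> y) = pairing U3 x y" for x y
    using lattice_isometry_pairing[OF \<eta>(1)] by simp
  obtain s t c d p q where f: "\<eta> f = ((s, t), (c, d), (p, q))" by (metis surj_pair)
  have t: "t = 1" using inv[of e f] ef \<eta>(2) f by simp
  have s: "s = - (c * d + p * q)" using inv[of f f] ff f t by (simp add: algebra_simps)
  let ?\<tau> = "\<lambda>((a, b), (c', d'), (p', q')).
        ((a + (c * d' + d * c' + (p * q' + q * p')) - b * (c * d + p * q), b),
         (c' - b * c, d' - b * d), (p' - b * p, q' - b * q))"
  show ?thesis
  proof (rule that[of "?\<tau> \<circ> \<eta>"])
    show "lattice_isometry U3 U3 (?\<tau> \<circ> \<eta>)"
      by (rule lattice_isometry_comp[OF \<eta>(1) lattice_isometry_Eichler_transvection])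
  qed (simp_all add: \<eta>(2) f t s algebra_simps)
qed

section \<open>Embeddings of Neron-Severi lattices\<close>

definition smul3 :: "int \<Rightarrow> (int \<times> int) \<times> (int \<times> int) \<times> (int \<times> int) \<Rightarrow> (int \<times> int) \<times> (int \<times> int) \<times> (int \<times> int)" where
  "smul3 k = map_prod (map_prod ((*) k) ((*) k)) (map_prod (map_prod ((*) k) ((*) k)) (map_prod ((*) k) ((*) k)))"

lemma smul3_simp [simp]:
  "smul3 k ((a, b), (c, d), (p, q)) = ((k * a, k * b), (k * c, k * d), (k * p, k * q))"
  by (simp add: smul3_def)

lemma smul3_0: "smul3 0 x = 0"
  by (cases x) (auto simp: zero_prod_def)

lemma smul3_add_1: "smul3 (k + 1) x = smul3 k x + x"
  by (cases x) (auto simp: algebra_simps)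

lemma smul3_diff_1: "smul3 (k - 1) x = smul3 k x - x"
  by (cases x) (auto simp: algebra_simps)

lemma additive_smul3:
  assumes add: "\<And>x y. f (x + y) = f x + f y"
  shows "f (smul3 k x) = smul3 k (f x)"
proof -
  have f0: "f 0 = 0" using add[of 0 0] by simp
  have diff: "f (x - y) = f x - f y" for x y using add[of "x - y" y] by (simp add: algebra_simps)
  show ?thesis
    by (induction k rule: int_induct[where k = 0])
       (simp_all add: smul3_0 smul3_add_1 smul3_diff_1 f0 add diff)
qed

definition perp :: "((int \<times> int) \<times> (int \<times> int)) set \<Rightarrow> ((int \<times> int) \<times> (int \<times> int)) set" where
  "perp S = {x. \<forall>y\<in>S. pairing U2 x y = 0}"

lemma pairing_U2_commute: "pairing U2 x y = pairing U2 y x"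
proof -
  obtain a b c d a' b' c' d' where "x = ((a, b), (c, d))" "y = ((a', b'), (c', d'))"
    by (metis surj_pair)
  then show ?thesis by (simp add: algebra_simps)
qed

text \<open>The general property of a Galois connection. It turns the complement of NS(X), which is
  itself a double complement, back into the simple one.\<close>

lemma perp_perp_perp: "perp (perp (perp S)) = perp S"
proof -
  have galois: "S \<subseteq> perp (perp S)" for S
  proof
    fix x assume "x \<in> S"
    then have "pairing U2 x y = 0" if "y \<in> perp S" for y
      using that pairing_U2_commute[of x y] unfolding perp_def by simp
    then show "x \<in> perp (perp S)" unfolding perp_def[of "perp S"] by blast
  qed
  have "T \<subseteq> S \<Longrightarrow> perp S \<subseteq> perp T" for S T
    unfolding perp_def by blast
  from this[OF galois] galois show ?thesis by (rule equalityI)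
qed

text \<open>These are the primitive sublattices, those with torsion-free quotient. They are
  determined by their rational span, so equality of two of them can be tested up to
  multiples.\<close>

definition saturated :: "((int \<times> int) \<times> (int \<times> int) \<times> (int \<times> int)) set \<Rightarrow> bool" where
  "saturated L \<longleftrightarrow> (\<forall>x\<in>L. \<forall>y\<in>L. x + y \<in> L) \<and> (\<forall>k. \<forall>x\<in>L. smul3 k x \<in> L) \<and>
     (\<forall>k x. k \<noteq> 0 \<longrightarrow> smul3 k x \<in> L \<longrightarrow> x \<in> L)"

lemma saturated_add: "saturated L \<Longrightarrow> x \<in> L \<Longrightarrow> y \<in> L \<Longrightarrow> x + y \<in> L"
  by (simp add: saturated_def)

lemma saturated_smul3: "saturated L \<Longrightarrow> x \<in> L \<Longrightarrow> smul3 k x \<in> L"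
  by (simp add: saturated_def)

lemma saturated_divide: "saturated L \<Longrightarrow> smul3 k x \<in> L \<Longrightarrow> k \<noteq> 0 \<Longrightarrow> x \<in> L"
  unfolding saturated_def by blast

lemma saturated_image:
  assumes "saturated L" "lattice_isometry U3 U3 f"
  shows "saturated (f ` L)"
proof -
  have add: "f (x + y) = f x + f y" for x y
    using lattice_isometry_add[OF assms(2), of x y] by simp
  have bij: "bij f" using assms(2) unfolding lattice_isometry_def elts_U3 by blast
  have div: "x \<in> f ` L" if k: "k \<noteq> 0" "smul3 k x \<in> f ` L" for k x
  proof -
    obtain z where z: "x = f z" using surjD[OF bij_is_surj[OF bij], of x] by blast
    have "f (smul3 k z) \<in> f ` L" using k(2) unfolding z additive_smul3[of f, OF add] .
    then have "smul3 k z \<in> L" using inj_image_mem_iff[OF bij_is_inj[OF bij]] by blast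
    then have "z \<in> L" using saturated_divide[OF assms(1) _ k(1)] by blast
    then show ?thesis unfolding z by (rule imageI)
  qed
  have sum: "x + y \<in> f ` L" if xy: "x \<in> f ` L" "y \<in> f ` L" for x y
  proof -
    obtain u v where "x = f u" "y = f v" "u \<in> L" "v \<in> L" using xy by (elim imageE)
    then show ?thesis
      using imageI[OF saturated_add[OF assms(1), of u v], of f] unfolding add by simp
  qed
  have mult: "smul3 k x \<in> f ` L" if x: "x \<in> f ` L" for k x
  proof -
    obtain u where "x = f u" "u \<in> L" using x by (elim imageE)
    then show ?thesis
      using imageI[OF saturated_smul3[OF assms(1), of u k], of f] unfolding additive_smul3[of f, OF add] by simp
  qed
  show ?thesis
    unfolding saturated_def using div sum mult by (intro conjI ballI allI impI)
qed

text \<open>For \<open>L\<close> the image of \<open>NS(X)\<close>, the complement \<open>perp {l\<^sub>0, l\<^sub>1, l\<^sub>2}\<close> is the Neron-Severi lattice of the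
  mirror partner, \<open>k\<close> its polarization up to sign, and the \<open>l\<^sub>i\<close> span the space in which its
  period is chosen.\<close>

definition admissible :: "((int \<times> int) \<times> (int \<times> int) \<times> (int \<times> int)) set \<Rightarrow> bool" where
  "admissible L \<longleftrightarrow> (\<exists>l\<^sub>0 l\<^sub>1 l\<^sub>2 k. L = {0} \<times> perp (perp {l\<^sub>0, l\<^sub>1, l\<^sub>2}) \<and>
     pairing U2 l\<^sub>0 l\<^sub>0 > 0 \<and> k \<in> perp {l\<^sub>0, l\<^sub>1, l\<^sub>2} \<and> pairing U2 k k > 0)"

text \<open>Saturation allows dividing the first vector by \<open>g\<close>, which gives
  \<open>v\<close> with middle component (1, n), and subtracting a multiple of \<open>v\<close> from
  the second gives \<open>w\<close>. Then \<open>L\<close> is the saturation of the span of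
  \<open>v\<close> and \<open>w\<close>, hence a double complement. The hypothesis
  \<open>neg\<close> is the Hodge index theorem; it supplies the positive vector of the
  complement.\<close>

lemma admissible_rank_two_normal_form:
  assumes L: "saturated L"
    and x: "((0, 0), (g, h), (0, 0)) \<in> L" "g dvd h" "g * h > 0"
    and y: "((0, 0), (s, t), (g', h')) \<in> L" "g' dvd h'"
    and span: "\<And>z. z \<in> L \<Longrightarrow> \<exists>m a b. m \<noteq> 0 \<and>
      smul3 m z = smul3 a ((0, 0), (g, h), (0, 0)) + smul3 b ((0, 0), (s, t), (g', h'))"
    and neg: "\<And>d. d \<in> L \<Longrightarrow> pairing U3 ((0, 0), (g, h), (0, 0)) d = 0 \<Longrightarrow> d \<noteq> 0 \<Longrightarrow> pairing U3 d d < 0"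
  shows "admissible L"
proof -
  obtain n where n: "h = g * n" using x(2) by blast
  have g: "g \<noteq> 0" using x(3) by auto
  have "0 < (g * g) * n" using x(3) n by (simp add: mult.assoc)
  then have n0: "n > 0" using zero_less_mult_pos[of "g * g" n] g by (simp add: zero_less_mult_iff)
  define v where "v = (((0, 0), (1, n), (0, 0)) :: (int \<times> int) \<times> (int \<times> int) \<times> (int \<times> int))"
  have v: "v \<in> L"
    by (rule saturated_divide[OF L _ g]) (use x n in \<open>simp add: v_def\<close>)
  define t' where "t' = t - s * n"
  define w where "w = (((0, 0), (0, t'), (g', h')) :: (int \<times> int) \<times> (int \<times> int) \<times> (int \<times> int))"
  have "((0, 0), (s, t), (g', h')) + smul3 (- s) v \<in> L"
    by (intro saturated_add[OF L] saturated_smul3[OF L] v y)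
  then have w: "w \<in> L" by (simp add: v_def w_def t'_def)
  have span': "\<exists>m a b. m \<noteq> 0 \<and> smul3 m z = smul3 a v + smul3 b w" if z: "z \<in> L" for z
  proof -
    obtain m a b where "m \<noteq> 0" "smul3 m z = smul3 a ((0, 0), (g, h), (0, 0)) + smul3 b ((0, 0), (s, t), (g', h'))"
      using span[OF z] by blast
    then have "m \<noteq> 0 \<and> smul3 m z = smul3 (a * g + b * s) v + smul3 b w"
      by (simp add: v_def w_def t'_def n algebra_simps)
    then show ?thesis by blast
  qed
  define l\<^sub>0 where "l\<^sub>0 = (((1, n), (0, 0)) :: (int \<times> int) \<times> (int \<times> int))"
  define l\<^sub>1 where "l\<^sub>1 = (((0, t'), (g', h')) :: (int \<times> int) \<times> (int \<times> int))"
  \<comment> \<open>Two vectors span, so the third slot of \<open>admissible\<close> is filled by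
    repeating \<open>l\<^sub>1\<close>.\<close>
  have perp_iff: "((a, b), (c, d)) \<in> perp {l\<^sub>0, l\<^sub>1, l\<^sub>1} \<longleftrightarrow>
      a * n + b = 0 \<and> a * t' + (c * h' + d * g') = 0" for a b c d
    by (simp add: perp_def l\<^sub>0_def l\<^sub>1_def)
  have sub: "z \<in> {0} \<times> perp (perp {l\<^sub>0, l\<^sub>1, l\<^sub>1})" if z: "z \<in> L" for z
  proof -
    obtain z5 z6 z1 z2 z3 z4 where zeq: "z = ((z5, z6), (z1, z2), (z3, z4))"
      by (metis surj_pair)
    obtain m a b where m: "m \<noteq> 0" and "smul3 m z = smul3 a v + smul3 b w"
      using span'[OF z] by blast
    then have eqs: "z5 = 0" "z6 = 0" "m * z1 = a" "m * z2 = a * n + b * t'" "m * z3 = b * g'" "m * z4 = b * h'"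
      by (auto simp: zeq v_def w_def)
    have "pairing U2 ((z1, z2), (z3, z4)) y = 0" if y: "y \<in> perp {l\<^sub>0, l\<^sub>1, l\<^sub>1}" for y
    proof -
      obtain y1 y2 y3 y4 where yeq: "y = ((y1, y2), (y3, y4))" by (metis surj_pair)
      have y': "y1 * n + y2 = 0" "y1 * t' + (y3 * h' + y4 * g') = 0"
        using y perp_iff yeq by auto
      have "m * pairing U2 ((z1, z2), (z3, z4)) y
        = (m * z1) * y2 + (m * z2) * y1 + ((m * z3) * y4 + (m * z4) * y3)"
        by (simp add: yeq algebra_simps)
      also have "\<dots> = a * (y1 * n + y2) + b * (y1 * t' + (y3 * h' + y4 * g'))"
        by (simp add: eqs algebra_simps)
      finally show ?thesis using m y' by simp
    qed
    then have "((z1, z2), (z3, z4)) \<in> perp (perp {l\<^sub>0, l\<^sub>1, l\<^sub>1})"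
      unfolding perp_def[of "perp _"] by blast
    then show ?thesis using eqs by (simp add: zeq zero_prod_def)
  qed
  have sup: "z \<in> L" if z: "z \<in> {0} \<times> perp (perp {l\<^sub>0, l\<^sub>1, l\<^sub>1})" for z
  proof -
    obtain z1 z2 z3 z4 where zeq: "z = ((0, 0), (z1, z2), (z3, z4))"
      using z by (metis mem_Sigma_iff singletonD surj_pair zero_prod_def)
    have zp: "z1 * b + z2 * a + (z3 * d + z4 * c) = 0"
      if "a * n + b = 0" "a * t' + (c * h' + d * g') = 0" for a b c d
      using z that perp_iff[of a b c d] unfolding zeq by (auto simp: perp_def[of "perp _"])
    show ?thesis
    \<comment> \<open>Pairing \<open>z\<close> with explicit elements of the complement yields
      linear relations between its coordinates. They express a multiple of \<open>z\<close> by
      \<open>v\<close> and \<open>w\<close>, the factor being a nonzero entry of \<open>w\<close>;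
      saturation removes it. If \<open>w\<close> vanishes, \<open>z\<close> is a multiple of
      \<open>v\<close> itself.\<close>
    proof (cases "g' = 0")
      case False
      have 1: "g' * z2 = g' * n * z1 + t' * z3"
        using zp[of g' "- (g' * n)" 0 "- t'"] by (simp add: algebra_simps)
      have 2: "g' * z4 = h' * z3"
        using zp[of 0 0 g' "- h'"] by (simp add: algebra_simps)
      have "smul3 g' z = smul3 (g' * z1) v + smul3 z3 w"
        using 1 2 by (simp add: zeq v_def w_def algebra_simps)
      also have "\<dots> \<in> L"
        by (intro saturated_add[OF L] saturated_smul3[OF L] v w)
      finally show ?thesis using saturated_divide[OF L _ False] by blast
    next
      case True
      then have h': "h' = 0" using y(2) by simp
      have 34: "z3 = 0" "z4 = 0"
        using zp[of 0 0 0 1] zp[of 0 0 1 0] True h' by simp_all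
      show ?thesis
      proof (cases "t' = 0")
        case False
        have "smul3 t' z = smul3 (t' * z1) v + smul3 (z2 - n * z1) w"
          using 34 by (simp add: zeq v_def w_def True h' algebra_simps)
        also have "\<dots> \<in> L"
          by (intro saturated_add[OF L] saturated_smul3[OF L] v w)
        finally show ?thesis using saturated_divide[OF L _ False] by blast
      next
        case t': True
        have "z2 = n * z1"
          using zp[of 1 "- n" 0 0] True h' t' by (simp add: algebra_simps)
        then have "z = smul3 z1 v" using 34 by (simp add: zeq v_def)
        then show ?thesis using saturated_smul3[OF L v] by simp
      qed
    qed
  qed
  have "\<exists>k. k \<in> perp {l\<^sub>0, l\<^sub>1, l\<^sub>1} \<and> pairing U2 k k > 0"
  proof (cases "g' = 0")
    case True
    then have "h' = 0" using y(2) by simp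
    \<comment> \<open>Here \<open>v\<close> and \<open>w\<close> lie in the same plane, so the whole
      other plane is orthogonal to them.\<close>
    then have "((0, 0), (1, 1)) \<in> perp {l\<^sub>0, l\<^sub>1, l\<^sub>1}" using True by (subst perp_iff) simp
    then show ?thesis by force
  next
    case False
    \<comment> \<open>The part of \<open>w\<close> orthogonal to \<open>v\<close>, cleared of
      denominators: \<open>v\<close> has square 2n and pairs with \<open>w\<close> to
      \<open>t'\<close>. Its negative square says that the Gram determinant of \<open>v\<close> and
      \<open>w\<close> is negative.\<close>
    define d where "d = smul3 (2 * n) w + smul3 (- t') v"
    have d: "d = ((0, 0), (- t', n * t'), (2 * n * g', 2 * n * h'))"
      by (simp add: d_def v_def w_def algebra_simps)
    have "d \<in> L" unfolding d_def
      by (intro saturated_add[OF L] saturated_smul3[OF L] v w)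
    moreover have "d \<noteq> 0" using False n0 by (simp add: d zero_prod_def)
    moreover have "pairing U3 ((0, 0), (g, h), (0, 0)) d = 0"
      by (simp add: d n algebra_simps)
    ultimately have "pairing U3 d d < 0" using neg by blast
    then have "2 * n * (4 * n * g' * h' - t' * t') < 0"
      by (simp add: d algebra_simps)
    then have 1: "t' * t' - 4 * n * g' * h' > 0"
      using n0 by (simp add: mult_less_0_iff)
    \<comment> \<open>Gram-Schmidt in the complement: u = ((g', - n g'), (0, - t')) has negative
      square - 2 n g'^2 there, and removing from ((0, 0), (g', - h')) its component along u gives
      this vector up to scaling.\<close>
    define k where "k = ((t' * g', - (t' * g' * n)), (- (2 * n * g' * g'), 2 * n * g' * h' - t' * t'))"
    have "k \<in> perp {l\<^sub>0, l\<^sub>1, l\<^sub>1}"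
      unfolding k_def by (subst perp_iff) (simp add: algebra_simps)
    moreover have "pairing U2 k k = (2 * n * (g' * g')) * (t' * t' - 4 * n * g' * h')"
      by (simp add: k_def algebra_simps)
    moreover have "(2 * n * (g' * g')) * (t' * t' - 4 * n * g' * h') > 0"
    proof (rule mult_pos_pos[OF mult_pos_pos 1])
      show "g' * g' > 0" using False by (auto simp: zero_less_mult_iff)
    qed (use n0 in simp)
    ultimately show ?thesis by metis
  qed
  moreover have "L = {0} \<times> perp (perp {l\<^sub>0, l\<^sub>1, l\<^sub>1})" using sub sup by blast
  moreover have "pairing U2 l\<^sub>0 l\<^sub>0 > 0" using n0 by (simp add: l\<^sub>0_def)
  ultimately show ?thesis unfolding admissible_def by blast
qed

text \<open>The Smith form puts \<open>x\<close> into the first plane. Isometries of the other two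
  planes fix it and can still bring the remaining part of \<open>y\<close> into the second plane.
  The cyclic permutation then moves the empty third plane to the front.\<close>

lemma admissible_rank_two:
  assumes L: "saturated L"
    and x: "x \<in> L" "pairing U3 x x > 0" and y: "y \<in> L"
    and span: "\<And>z. z \<in> L \<Longrightarrow> \<exists>m a b. m \<noteq> 0 \<and> smul3 m z = smul3 a x + smul3 b y"
    and neg: "\<And>d. d \<in> L \<Longrightarrow> pairing U3 x d = 0 \<Longrightarrow> d \<noteq> 0 \<Longrightarrow> pairing U3 d d < 0"
  obtains \<phi> where "lattice_isometry U3 U3 \<phi>" "admissible (\<phi> ` L)"
proof -
  obtain g h \<psi>\<^sub>1 where \<psi>\<^sub>1: "lattice_isometry U3 U3 \<psi>\<^sub>1" "\<psi>\<^sub>1 x = ((g, h), (0, 0), (0, 0))" and gh: "g dvd h"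
    using Smith_U3[of x] unfolding moves_def by blast
  obtain s t m where y1: "\<psi>\<^sub>1 y = ((s, t), m)" by (metis surj_pair)
  obtain g' h' \<psi>\<^sub>2 where \<psi>\<^sub>2: "lattice_isometry U2 U2 \<psi>\<^sub>2" "\<psi>\<^sub>2 m = ((g', h'), (0, 0))" and gh': "g' dvd h'"
    using Smith_U2[of m] unfolding moves_def by blast
  have \<psi>\<^sub>2_0: "\<psi>\<^sub>2 ((0, 0), (0, 0)) = ((0, 0), (0, 0))"
    using lattice_isometry_add[OF \<psi>\<^sub>2(1), of 0 0] by (simp add: zero_prod_def)
  define \<phi> where "\<phi> = (\<lambda>(x, y, z). (z, x, y)) \<circ> (map_prod id \<psi>\<^sub>2 \<circ> \<psi>\<^sub>1)"
  have \<phi>: "lattice_isometry U3 U3 \<phi>"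
    unfolding \<phi>_def
    by (rule lattice_isometry_comp[OF lattice_isometry_comp[OF \<psi>\<^sub>1(1)] lattice_isometry_cycle])
       (unfold U3_def, intro lattice_isometry_orth_sum lattice_isometry_id \<psi>\<^sub>2(1))
  have x': "\<phi> x = ((0, 0), (g, h), (0, 0))"
    by (simp add: \<phi>_def \<psi>\<^sub>1(2) \<psi>\<^sub>2_0)
  have y': "\<phi> y = ((0, 0), (s, t), (g', h'))"
    by (simp add: \<phi>_def y1 \<psi>\<^sub>2(2))
  have inv: "pairing U3 (\<phi> a) (\<phi> b) = pairing U3 a b" for a b
    using lattice_isometry_pairing[OF \<phi>, of a b] by simp
  have add: "\<phi> (a + b) = \<phi> a + \<phi> b" for a b
    using lattice_isometry_add[OF \<phi>, of a b] by simp
  have \<phi>0: "\<phi> 0 = 0" using add[of 0 0] by simp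
  note sm = additive_smul3[of \<phi>, OF add]
  have "admissible (\<phi> ` L)"
  proof (rule admissible_rank_two_normal_form[where g = g and h = h and s = s and t = t and g' = g' and h' = h'])
    show "saturated (\<phi> ` L)" using saturated_image[OF L \<phi>] .
    show "((0, 0), (g, h), (0, 0)) \<in> \<phi> ` L" using x(1) x' by (metis imageI)
    show "((0, 0), (s, t), (g', h')) \<in> \<phi> ` L" using y(1) y' by (metis imageI)
    show "g * h > 0" using x(2) inv[of x x] by (simp add: x')
    show "\<exists>m a b. m \<noteq> 0 \<and> smul3 m z = smul3 a ((0, 0), (g, h), (0, 0)) + smul3 b ((0, 0), (s, t), (g', h'))"
      if "z \<in> \<phi> ` L" for z
      using that span by (metis (no_types, lifting) add imageE sm x' y')
    show "pairing U3 d d < 0"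
      if "d \<in> \<phi> ` L" "pairing U3 ((0, 0), (g, h), (0, 0)) d = 0" "d \<noteq> 0" for d
      using that neg inv by (metis \<phi>0 imageE x')
  qed (use gh gh' in auto)
  then show ?thesis using \<phi> that by blast
qed

text \<open>The summand U is a hyperbolic pair and moves to the first plane. The generator of the
  other summand is orthogonal to it, so it lies in the remaining two planes and has a Smith form (g,
  h) there, with \<open>g * h = - n\<close>. The vector (g, - h) is orthogonal to everything and has
  square 2n.\<close>

lemma admissible_rank_three:
  assumes L: "saturated L" and n: "n > 0"
    and iso: "lattice_isometry (orth_sum (Z_lattice (- 2 * n)) U_lattice) (U3\<lparr>elts := L\<rparr>) f"
  obtains \<phi> where "lattice_isometry U3 U3 \<phi>" "admissible (\<phi> ` L)"
proof -
  define M where "M = orth_sum (Z_lattice (- 2 * n)) U_lattice"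
  have M: "elts M = UNIV" by (simp add: M_def Z_lattice_def)
  note iso = iso[folded M_def]
  have pM: "pairing M (a, b, c) (a', b', c') = - 2 * n * a * a' + (b * c' + c * b')" for a b c a' b' c'
    by (simp add: M_def Z_lattice_def)
  have inv: "pairing U3 (f u) (f v) = pairing M u v" for u v
    using lattice_isometry_pairing[OF iso, of u v] M by simp
  have add: "f (u + v) = f u + f v" for u v
    using lattice_isometry_add[OF iso, of u v] M by simp
  have L_eq: "L = range f" using iso M by (auto simp: lattice_isometry_def bij_betw_def)
  obtain \<psi>\<^sub>1 where \<psi>\<^sub>1: "lattice_isometry U3 U3 \<psi>\<^sub>1"
    "\<psi>\<^sub>1 (f (0, 1, 0)) = ((1, 0), (0, 0), (0, 0))" "\<psi>\<^sub>1 (f (0, 0, 1)) = ((0, 1), (0, 0), (0, 0))"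
    by (rule hyperbolic_pair_standard[of "f (0, 1, 0)" "f (0, 0, 1)"]) (simp_all add: inv pM)
  have inv1: "pairing U3 (\<psi>\<^sub>1 a) (\<psi>\<^sub>1 b) = pairing U3 a b" for a b
    using lattice_isometry_pairing[OF \<psi>\<^sub>1(1), of a b] by simp
  obtain s t m where m: "\<psi>\<^sub>1 (f (1, 0, 0)) = ((s, t), m)" by (metis surj_pair)
  have "t = 0"
    using inv1[of "f (0, 1, 0)" "f (1, 0, 0)"] unfolding \<psi>\<^sub>1 m
    by (cases m) (auto simp: inv pM)
  moreover have "s = 0"
    using inv1[of "f (0, 0, 1)" "f (1, 0, 0)"] unfolding \<psi>\<^sub>1 m
    by (cases m) (auto simp: inv pM)
  ultimately have m: "\<psi>\<^sub>1 (f (1, 0, 0)) = ((0, 0), m)" using m by simp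
  obtain g h \<psi>\<^sub>2 where \<psi>\<^sub>2: "lattice_isometry U2 U2 \<psi>\<^sub>2" "\<psi>\<^sub>2 m = ((g, h), (0, 0))" and gh: "g dvd h"
    using Smith_U2[of m] unfolding moves_def by blast
  have \<psi>\<^sub>2_0: "\<psi>\<^sub>2 ((0, 0), (0, 0)) = ((0, 0), (0, 0))"
    using lattice_isometry_add[OF \<psi>\<^sub>2(1), of 0 0] by (simp add: zero_prod_def)
  define \<phi> where "\<phi> = (\<lambda>(x, y, z). (z, x, y)) \<circ> (map_prod id \<psi>\<^sub>2 \<circ> \<psi>\<^sub>1)"
  have \<phi>: "lattice_isometry U3 U3 \<phi>"
    unfolding \<phi>_def
    by (rule lattice_isometry_comp[OF lattice_isometry_comp[OF \<psi>\<^sub>1(1)] lattice_isometry_cycle])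
       (unfold U3_def, intro lattice_isometry_orth_sum lattice_isometry_id \<psi>\<^sub>2(1))
  define e where "e = \<phi> (f (0, 1, 0))"
  define e' where "e' = \<phi> (f (0, 0, 1))"
  define w where "w = \<phi> (f (1, 0, 0))"
  have e: "e = ((0, 0), (1, 0), (0, 0))" and e': "e' = ((0, 0), (0, 1), (0, 0))"
    and w: "w = ((0, 0), (0, 0), (g, h))"
    by (simp_all add: e_def e'_def w_def \<phi>_def \<psi>\<^sub>1 \<psi>\<^sub>2_0 m \<psi>\<^sub>2(2))
  have addg: "\<phi> (f (u + v)) = \<phi> (f u) + \<phi> (f v)" for u v
    using lattice_isometry_add[OF \<phi>, of "f u" "f v"] add by simp
  have S: "saturated (\<phi> ` L)" using saturated_image[OF L \<phi>] .
  have mem: "e \<in> \<phi> ` L" "e' \<in> \<phi> ` L" "w \<in> \<phi> ` L"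
    by (simp_all add: e_def e'_def w_def L_eq)
  have invg: "pairing U3 (\<phi> (f u)) (\<phi> (f v)) = pairing M u v" for u v
    using lattice_isometry_pairing[OF \<phi>, of "f u" "f v"] inv by simp
  have "pairing U3 w w = - 2 * n"
    using invg[of "(1, 0, 0)" "(1, 0, 0)"] unfolding w_def pM by simp
  then have ghn: "g * h = - n" by (simp add: w)
  then have g0: "g \<noteq> 0" using n by auto
  \<comment> \<open>Any two generators of the first plane would do up to sign and order, except that
    \<open>admissible\<close> asks for a first vector of positive square; hence (1, 1).\<close>
  define l\<^sub>0 where "l\<^sub>0 = (((1, 1), (0, 0)) :: (int \<times> int) \<times> (int \<times> int))"
  define l\<^sub>1 where "l\<^sub>1 = (((1, 0), (0, 0)) :: (int \<times> int) \<times> (int \<times> int))"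
  define l\<^sub>2 where "l\<^sub>2 = (((0, 0), (g, h)) :: (int \<times> int) \<times> (int \<times> int))"
  have perp_iff: "((a, b), (c, d)) \<in> perp {l\<^sub>0, l\<^sub>1, l\<^sub>2} \<longleftrightarrow> a = 0 \<and> b = 0 \<and> c * h + d * g = 0" for a b c d
    by (auto simp: perp_def l\<^sub>0_def l\<^sub>1_def l\<^sub>2_def)
  have \<phi>f: "\<phi> (f (a, b, c)) = ((0, 0), (b, c), (a * g, a * h))" for a b c
  proof -
    have 1: "\<phi> (f (a, 0, 0)) = ((0, 0), (0, 0), (a * g, a * h))" for a
    proof -
      have z: "\<phi> (f (0, 0, 0)) = ((0, 0), (0, 0), (0, 0))"
        using addg[of 0 0] by (simp add: zero_prod_def)
      have S: "\<phi> (f (a + 1, 0, 0)) = \<phi> (f (a, 0, 0)) + w" for a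
        using addg[of "(a, 0, 0)" "(1, 0, 0)"] by (simp add: w_def)
      have D: "\<phi> (f (a - 1, 0, 0)) = \<phi> (f (a, 0, 0)) - w" for a
        using S[of "a - 1"] by simp
      show ?thesis
        by (induction a rule: int_induct[where k = 0]) (simp_all add: z S D w algebra_simps zero_prod_def)
    qed
    have 2: "\<phi> (f (0, b, 0)) = ((0, 0), (b, 0), (0, 0))" for b
    proof -
      have z: "\<phi> (f (0, 0, 0)) = ((0, 0), (0, 0), (0, 0))"
        using addg[of 0 0] by (simp add: zero_prod_def)
      have S: "\<phi> (f (0, a + 1, 0)) = \<phi> (f (0, a, 0)) + e" for a
        using addg[of "(0, a, 0)" "(0, 1, 0)"] by (simp add: e_def)
      have D: "\<phi> (f (0, a - 1, 0)) = \<phi> (f (0, a, 0)) - e" for a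
        using S[of "a - 1"] by simp
      show ?thesis
        by (induction b rule: int_induct[where k = 0]) (simp_all add: z S D e zero_prod_def)
    qed
    have 3: "\<phi> (f (0, 0, c)) = ((0, 0), (0, c), (0, 0))" for c
    proof -
      have z: "\<phi> (f (0, 0, 0)) = ((0, 0), (0, 0), (0, 0))"
        using addg[of 0 0] by (simp add: zero_prod_def)
      have S: "\<phi> (f (0, 0, a + 1)) = \<phi> (f (0, 0, a)) + e'" for a
        using addg[of "(0, 0, a)" "(0, 0, 1)"] by (simp add: e'_def)
      have D: "\<phi> (f (0, 0, a - 1)) = \<phi> (f (0, 0, a)) - e'" for a
        using S[of "a - 1"] by simp
      show ?thesis
        by (induction c rule: int_induct[where k = 0]) (simp_all add: z S D e' zero_prod_def)
    qed
    show ?thesis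
      using addg[of "(a, 0, 0)" "(0, b, c)"] addg[of "(0, b, 0)" "(0, 0, c)"] 1[of a] 2[of b] 3[of c] by simp
  qed
  have sub: "z \<in> {0} \<times> perp (perp {l\<^sub>0, l\<^sub>1, l\<^sub>2})" if z: "z \<in> \<phi> ` L" for z
  proof -
    obtain u where "z = \<phi> (f u)" using z L_eq by blast
    then obtain a b c where z: "z = ((0, 0), (b, c), (a * g, a * h))"
      using \<phi>f by (metis surj_pair)
    have "pairing U2 ((b, c), (a * g, a * h)) y = 0" if "y \<in> perp {l\<^sub>0, l\<^sub>1, l\<^sub>2}" for y
    proof -
      obtain y1 y2 y3 y4 where yeq: "y = ((y1, y2), (y3, y4))" by (metis surj_pair)
      then have y: "y1 = 0" "y2 = 0" "y3 * h + y4 * g = 0" using that perp_iff by auto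
      have "pairing U2 ((b, c), (a * g, a * h)) y = a * (y3 * h + y4 * g)"
        by (simp add: yeq y algebra_simps)
      then show ?thesis using y by simp
    qed
    then have "((b, c), (a * g, a * h)) \<in> perp (perp {l\<^sub>0, l\<^sub>1, l\<^sub>2})"
      unfolding perp_def[of "perp _"] by blast
    then show ?thesis by (simp add: z zero_prod_def)
  qed
  have sup: "z \<in> \<phi> ` L" if z: "z \<in> {0} \<times> perp (perp {l\<^sub>0, l\<^sub>1, l\<^sub>2})" for z
  proof -
    obtain z1 z2 z3 z4 where zeq: "z = ((0, 0), (z1, z2), (z3, z4))"
      using z by (metis mem_Sigma_iff singletonD surj_pair zero_prod_def)
    have "pairing U2 ((z1, z2), (z3, z4)) ((0, 0), (g, - h)) = 0"
      using z perp_iff[of 0 0 g "- h"] unfolding zeq by (auto simp: perp_def[of "perp _"])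
    then have "g * z4 = h * z3" by (simp add: algebra_simps)
    then have "smul3 g z = smul3 (g * z1) e + (smul3 (g * z2) e' + smul3 z3 w)"
      by (simp add: zeq e e' w algebra_simps)
    also have "\<dots> \<in> \<phi> ` L"
      by (intro saturated_add[OF S] saturated_smul3[OF S] mem)
    finally show ?thesis using saturated_divide[OF S _ g0] by blast
  qed
  have "\<phi> ` L = {0} \<times> perp (perp {l\<^sub>0, l\<^sub>1, l\<^sub>2})" using sub sup by blast
  moreover have "pairing U2 l\<^sub>0 l\<^sub>0 > 0" by (simp add: l\<^sub>0_def)
  moreover have "((0, 0), (g, - h)) \<in> perp {l\<^sub>0, l\<^sub>1, l\<^sub>2}" by (subst perp_iff) simp
  moreover have "pairing U2 ((0, 0), (g, - h)) ((0, 0), (g, - h)) > 0" using ghn n by (simp add: algebra_simps)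
  ultimately have "admissible (\<phi> ` L)" unfolding admissible_def by blast
  then show ?thesis using \<phi> that by blast
qed

section \<open>Ranks of subgroups with integral coordinates\<close>

text \<open>Gaussian elimination without fractions: a pivot clears the last coordinate of the other
  vectors, and a relation between the reduced vectors lifts to the original ones.\<close>

lemma integer_relation:
  fixes f :: "'a \<Rightarrow> nat \<Rightarrow> int"
  assumes "finite S" "card S > n"
  shows "\<exists>c. (\<exists>s\<in>S. c s \<noteq> 0) \<and> (\<forall>i<n. (\<Sum>s\<in>S. c s * f s i) = 0)"
  using assms
proof (induction n arbitrary: S f)
  case 0
  then show ?case by (intro exI[of _ "\<lambda>_. 1"]) (auto simp: card_gt_0_iff)
next
  case (Suc n)
  show ?case
  proof (cases "\<forall>s\<in>S. f s n = 0")
    case True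
    obtain c where c: "\<exists>s\<in>S. c s \<noteq> 0" "\<And>i. i < n \<Longrightarrow> (\<Sum>s\<in>S. c s * f s i) = 0"
      using Suc.IH[of S f] Suc.prems by auto
    have "(\<Sum>s\<in>S. c s * f s n) = 0" using True by simp
    then show ?thesis using c by (intro exI[of _ c]) (auto simp: less_Suc_eq)
  next
    case False
    then obtain p where p: "p \<in> S" "f p n \<noteq> 0" by blast
    define S' where "S' = S - {p}"
    define g where "g s i = f p n * f s i - f s n * f p i" for s i
    have S': "finite S'" "card S' > n" using Suc.prems p by (auto simp: S'_def)
    obtain c where c: "\<exists>s\<in>S'. c s \<noteq> 0" "\<And>i. i < n \<Longrightarrow> (\<Sum>s\<in>S'. c s * g s i) = 0"
      using Suc.IH[OF S', of g] by auto
    \<comment> \<open>The other coefficients are multiplied by the pivot entry, which keeps them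
      nonzero, and the coefficient of the pivot is the one that cancels the last coordinate.\<close>
    define d where "d s = (if s = p then - (\<Sum>s\<in>S'. c s * f s n) else f p n * c s)" for s
    have S: "S = insert p S'" "p \<notin> S'" using p by (auto simp: S'_def)
    have "(\<Sum>s\<in>S. d s * f s i) = (\<Sum>s\<in>S'. c s * g s i)" for i
    proof -
      have "(\<Sum>s\<in>S. d s * f s i) = d p * f p i + (\<Sum>s\<in>S'. d s * f s i)"
        using S S'(1) by simp
      also have "(\<Sum>s\<in>S'. d s * f s i) = (\<Sum>s\<in>S'. f p n * c s * f s i)"
        using S(2) by (intro sum.cong) (auto simp: d_def)
      also have "d p * f p i = - (\<Sum>s\<in>S'. c s * f s n * f p i)"
        by (simp add: d_def sum_distrib_right)
      also have "- (\<Sum>s\<in>S'. c s * f s n * f p i) + (\<Sum>s\<in>S'. f p n * c s * f s i) = (\<Sum>s\<in>S'. c s * g s i)"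
        by (simp add: g_def algebra_simps sum_subtractf)
      finally show ?thesis .
    qed
    moreover have "(\<Sum>s\<in>S'. c s * g s n) = 0" by (simp add: g_def algebra_simps)
    moreover have "\<exists>s\<in>S. d s \<noteq> 0" using c(1) p(2) S by (auto simp: d_def)
    ultimately show ?thesis using c(2) by (intro exI[of _ d]) (auto simp: less_Suc_eq)
  qed
qed

text \<open>An embedding of a subgroup into the free group of rank n; only the indices below
  \<open>n\<close> count for injectivity. It is used with the six coordinates of H^2 to exploit
  small rank, and with three coordinates to bound the Picard number of a surface with a mirror
  partner.\<close>

locale integral_coordinates =
  fixes A :: "'b::real_vector set" and \<kappa> :: "'b \<Rightarrow> nat \<Rightarrow> int" and n :: nat
  assumes subspace: "zmod.subspace A"
    and add: "x \<in> A \<Longrightarrow> y \<in> A \<Longrightarrow> \<kappa> (x + y) i = \<kappa> x i + \<kappa> y i"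
    and inj: "x \<in> A \<Longrightarrow> (\<And>i. i < n \<Longrightarrow> \<kappa> x i = 0) \<Longrightarrow> x = 0"
begin

lemma zero: "\<kappa> 0 i = 0"
  using add[of 0 0 i] zmod.subspace_0[OF subspace] by simp

lemma scale: "x \<in> A \<Longrightarrow> \<kappa> (zscale k x) i = k * \<kappa> x i"
proof (induction k rule: int_induct[where k = 0])
  case (step1 k)
  then show ?case
    using add[OF zmod.subspace_scale[OF subspace, of x k], of x i]
    by (simp add: zmod.scale_left_distrib algebra_simps)
next
  case (step2 k)
  then show ?case
    using add[OF zmod.subspace_scale[OF subspace, of x "k - 1"], of x i]
    by (simp add: zmod.scale_left_diff_distrib algebra_simps)
qed (simp add: zero)

lemma sum_scale: "S \<subseteq> A \<Longrightarrow> \<kappa> (\<Sum>s\<in>S. zscale (c s) s) i = (\<Sum>s\<in>S. c s * \<kappa> s i)"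
proof (induction S rule: infinite_finite_induct)
  case (insert s S)
  then have "(\<Sum>s\<in>S. zscale (c s) s) \<in> A" "zscale (c s) s \<in> A"
    using subspace by (auto intro!: zmod.subspace_sum zmod.subspace_scale)
  then show ?case using insert by (simp add: add scale)
qed (simp_all add: zero)

text \<open>Besides bounding the rank, this shows that the greatest cardinality in the definition of
  \<open>zrank\<close> is attained.\<close>

lemma card_independent_le:
  assumes "B \<subseteq> A" "finite B" "zmod.independent B"
  shows "card B \<le> n"
proof (rule ccontr)
  assume "\<not> card B \<le> n"
  then obtain c where c: "\<exists>s\<in>B. c s \<noteq> 0" "\<And>i. i < n \<Longrightarrow> (\<Sum>s\<in>B. c s * \<kappa> s i) = 0"
    using integer_relation[OF assms(2), of n \<kappa>] by auto
  have "(\<Sum>s\<in>B. zscale (c s) s) = 0"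
    using c(2) assms(1) subspace
    by (intro inj) (auto simp: sum_scale intro!: zmod.subspace_sum zmod.subspace_scale)
  then show False using c(1) assms(2,3) zmod.dependent_finite by blast
qed

lemma card_independent_le_zrank:
  assumes "B \<subseteq> A" "finite B" "zmod.independent B"
  shows "card B \<le> zrank A"
  unfolding zrank_def
  by (rule Greatest_le_nat[where b = n]) (use assms card_independent_le in auto)

lemma zrank_basis: "\<exists>B\<subseteq>A. finite B \<and> zmod.independent B \<and> card B = zrank A"
  unfolding zrank_def
  by (rule GreatestI_nat[where k = 0 and b = n]) (use card_independent_le zmod.independent_empty in \<open>auto intro!: exI[of _ "{}"]\<close>)

lemma zrank_le: "zrank A \<le> n"
  using zrank_basis card_independent_le by metis

text \<open>At full rank the image has finite index, so every integral vector \<open>t\<close> has a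
  nonzero multiple in it: adding \<open>t\<close> to a maximal independent set gives n + 1 vectors,
  and independence forces \<open>t\<close> to occur in a relation between them.\<close>

lemma full_rank:
  assumes "zrank A = n"
  shows "\<exists>m x. m \<noteq> 0 \<and> x \<in> A \<and> (\<forall>i<n. \<kappa> x i = m * t i)"
proof -
  obtain B where B: "B \<subseteq> A" "finite B" "zmod.independent B" "card B = n"
    using zrank_basis assms by blast
  \<comment> \<open>The index \<open>None\<close> stands for \<open>t\<close>, so that it is counted
    separately even if it equals the coordinate vector of an element of \<open>B\<close>.\<close>
  define S where "S = insert None (Some ` B)"
  define f where "f = case_option t \<kappa>"
  have "finite S" "card S > n" using B by (auto simp: S_def card_image)
  then obtain c where c: "\<exists>s\<in>S. c s \<noteq> 0" "\<And>i. i < n \<Longrightarrow> (\<Sum>s\<in>S. c s * f s i) = 0"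
    using integer_relation[of S n f] by blast
  define x where "x = (\<Sum>s\<in>B. zscale (c (Some s)) s)"
  have x: "x \<in> A" unfolding x_def using B(1) subspace
    by (intro zmod.subspace_sum zmod.subspace_scale) auto
  have sum: "(\<Sum>s\<in>S. c s * f s i) = c None * t i + \<kappa> x i" for i
    using B by (simp add: S_def f_def x_def sum_scale sum.reindex)
  have "c None \<noteq> 0"
  proof
    assume 0: "c None = 0"
    then have "\<kappa> x i = 0" if "i < n" for i using c(2)[OF that] sum[of i] by simp
    then have "x = 0" using inj[OF x] by blast
    moreover have "\<exists>s\<in>B. c (Some s) \<noteq> 0" using c(1) 0 by (auto simp: S_def)
    ultimately have "zmod.dependent B"
      unfolding zmod.dependent_finite[OF B(2)] x_def by (intro exI[of _ "\<lambda>s. c (Some s)"] conjI)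
    then show False using B(3) by simp
  qed
  then have "- c None \<noteq> 0 \<and> x \<in> A \<and> (\<forall>i<n. \<kappa> x i = - c None * t i)"
    using x c(2) sum by (auto simp: eq_neg_iff_add_eq_0 add.commute)
  then show ?thesis by blast
qed

text \<open>The rational span of \<open>A\<close> is generated by \<open>x\<close> and one further
  vector, which is 0 in rank one. An element outside this span would give three independent
  elements.\<close>

lemma zrank_le_2D:
  assumes "zrank A \<le> 2" "x \<in> A" "x \<noteq> 0"
  shows "\<exists>y\<in>A. \<forall>z\<in>A. \<exists>m a b. m \<noteq> 0 \<and> zscale m z = zscale a x + zscale b y"
proof (cases "\<forall>z\<in>A. \<exists>m a. m \<noteq> 0 \<and> zscale m z = zscale a x")
  case True
  have "0 \<in> A" using zmod.subspace_0[OF subspace] .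
  moreover have "\<exists>m a b. m \<noteq> 0 \<and> zscale m z = zscale a x + zscale b 0" if "z \<in> A" for z
    using True that by simp
  ultimately show ?thesis by blast
next
  case False
  then obtain y where y: "y \<in> A" "\<And>m a. m \<noteq> 0 \<Longrightarrow> zscale m y \<noteq> zscale a x" by blast
  have "\<exists>m a b. m \<noteq> 0 \<and> zscale m z = zscale a x + zscale b y" if z: "z \<in> A" for z
  proof (rule ccontr)
    assume "\<nexists>m a b. m \<noteq> 0 \<and> zscale m z = zscale a x + zscale b y"
    then have nz: "m \<noteq> 0 \<Longrightarrow> zscale m z \<noteq> zscale a x + zscale b y" for m a b by blast
    have "x \<noteq> y" using y(2)[of 1 1] by auto
    moreover have "x \<noteq> z" using nz[of 1 1 0] by auto
    moreover have "y \<noteq> z" using nz[of 1 0 1] by auto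
    ultimately have card: "card {x, y, z} = 3" by simp
    have "zmod.independent {x, y, z}"
    proof
      assume "zmod.dependent {x, y, z}"
      then obtain u where u: "\<exists>v\<in>{x, y, z}. u v \<noteq> 0" "(\<Sum>v\<in>{x, y, z}. zscale (u v) v) = 0"
        by (auto simp: zmod.dependent_finite)
      have e: "zscale (u x) x + (zscale (u y) y + zscale (u z) z) = 0"
        using u(2) \<open>x \<noteq> y\<close> \<open>x \<noteq> z\<close> \<open>y \<noteq> z\<close> by simp
      have "u z = 0"
      proof (rule ccontr)
        assume "u z \<noteq> 0"
        moreover have "zscale (u z) z = zscale (- u x) x + zscale (- u y) y"
          using e by (simp add: eq_neg_iff_add_eq_0 add.commute add.left_commute algebra_simps)
        ultimately show False using nz by blast
      qed
      then have e: "zscale (u x) x + zscale (u y) y = 0" using e by simp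
      have "u y = 0"
      proof (rule ccontr)
        assume "u y \<noteq> 0"
        moreover have "zscale (u y) y = zscale (- u x) x"
          using e by (simp add: eq_neg_iff_add_eq_0 add.commute)
        ultimately show False using y(2) by blast
      qed
      then have "zscale (u x) x = 0" using e by simp
      then have "u x = 0" using assms(3) by (simp add: zscale_def)
      then show False using u(1) \<open>u y = 0\<close> \<open>u z = 0\<close> by auto
    qed
    then have "3 \<le> zrank A"
      using card_independent_le_zrank[of "{x, y, z}"] card assms(2) y(1) z by simp
    then show False using assms(1) by simp
  qed
  then show ?thesis using y(1) by blast
qed

end

text \<open>With the pair in the first plane and \<open>v\<close> in the form (g, g n) in the
  second, n is positive because \<open>v\<close> has square 2 g^2 n. The complement is generated by
  (1, - n) in the second plane, of square - 2n, and by the third plane.\<close>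

lemma orthogonal_complement_of_U_plus_vector:
  assumes ee: "pairing U3 e e = 0" and ff: "pairing U3 f f = 0" and ef: "pairing U3 e f = 1"
    and ev: "pairing U3 e v = 0" and fv: "pairing U3 f v = 0" and vv: "pairing U3 v v > 0"
  obtains n \<iota> where "n > 0"
    "lattice_isometry (orth_sum (Z_lattice (- 2 * n)) U_lattice)
      (U3\<lparr>elts := {x. pairing U3 e x = 0 \<and> pairing U3 f x = 0 \<and> pairing U3 v x = 0}\<rparr>) \<iota>"
proof -
  obtain \<psi>\<^sub>1 where \<psi>\<^sub>1: "lattice_isometry U3 U3 \<psi>\<^sub>1"
    "\<psi>\<^sub>1 e = ((1, 0), (0, 0), (0, 0))" "\<psi>\<^sub>1 f = ((0, 1), (0, 0), (0, 0))"
    using hyperbolic_pair_standard[OF ee ff ef] .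
  have inv1: "pairing U3 (\<psi>\<^sub>1 a) (\<psi>\<^sub>1 b) = pairing U3 a b" for a b
    using lattice_isometry_pairing[OF \<psi>\<^sub>1(1), of a b] by simp
  obtain s t m where m: "\<psi>\<^sub>1 v = ((s, t), m)" by (metis surj_pair)
  have "t = 0" using inv1[of e v] unfolding \<psi>\<^sub>1 m by (cases m) (auto simp: ev)
  moreover have "s = 0" using inv1[of f v] unfolding \<psi>\<^sub>1 m by (cases m) (auto simp: fv)
  ultimately have m: "\<psi>\<^sub>1 v = ((0, 0), m)" using m by simp
  obtain g h \<psi>\<^sub>2 where \<psi>\<^sub>2: "lattice_isometry U2 U2 \<psi>\<^sub>2" "\<psi>\<^sub>2 m = ((g, h), (0, 0))" and gh: "g dvd h"
    using Smith_U2[of m] unfolding moves_def by blast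
  have \<psi>\<^sub>2_0: "\<psi>\<^sub>2 ((0, 0), (0, 0)) = ((0, 0), (0, 0))"
    using lattice_isometry_add[OF \<psi>\<^sub>2(1), of 0 0] by (simp add: zero_prod_def)
  define \<phi> where "\<phi> = map_prod id \<psi>\<^sub>2 \<circ> \<psi>\<^sub>1"
  have \<phi>: "lattice_isometry U3 U3 \<phi>"
    unfolding \<phi>_def
    by (rule lattice_isometry_comp[OF \<psi>\<^sub>1(1)])
       (unfold U3_def, intro lattice_isometry_orth_sum lattice_isometry_id \<psi>\<^sub>2(1))
  have img: "\<phi> e = ((1, 0), (0, 0), (0, 0))" "\<phi> f = ((0, 1), (0, 0), (0, 0))" "\<phi> v = ((0, 0), (g, h), (0, 0))"
    by (simp_all add: \<phi>_def \<psi>\<^sub>1 \<psi>\<^sub>2_0 m \<psi>\<^sub>2(2))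
  have inv: "pairing U3 (\<phi> a) (\<phi> b) = pairing U3 a b" for a b
    using lattice_isometry_pairing[OF \<phi>, of a b] by simp
  obtain n where n: "h = g * n" using gh by blast
  have "g * h > 0" using inv[of v v] vv by (simp add: img)
  then have g: "g \<noteq> 0" and "0 < (g * g) * n" using n by (auto simp: mult.assoc)
  then have n0: "n > 0" using zero_less_mult_pos[of "g * g" n] by (simp add: zero_less_mult_iff)
  define \<iota> where "\<iota> = inv \<phi> \<circ> (\<lambda>(a, p, q). ((0, 0), (a, - (n * a)), (p, q)))"
  define W where "W = {x. pairing U3 e x = 0 \<and> pairing U3 f x = 0 \<and> pairing U3 v x = 0}"
  define W' where "W' = {x. pairing U3 (\<phi> e) x = 0 \<and> pairing U3 (\<phi> f) x = 0 \<and> pairing U3 (\<phi> v) x = 0}"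
  have \<phi>bij: "bij \<phi>" using \<phi> unfolding lattice_isometry_def elts_U3 by blast
  have \<phi>i: "lattice_isometry U3 U3 (inv \<phi>)"
    using lattice_isometry_inv_into[OF \<phi>] by simp
  have W: "bij_betw (inv \<phi>) W' W"
  proof (rule bij_betw_byWitness[where f' = \<phi>])
    show "\<forall>a\<in>W'. \<phi> (inv \<phi> a) = a" using \<phi>bij by (simp add: bij_is_surj surj_f_inv_f)
    show "\<forall>a\<in>W. inv \<phi> (\<phi> a) = a" using \<phi>bij by (simp add: bij_is_inj)
    show "inv \<phi> ` W' \<subseteq> W"
    proof
      fix y assume "y \<in> inv \<phi> ` W'"
      then have "\<phi> y \<in> W'" using \<phi>bij by (auto simp: bij_is_surj surj_f_inv_f)
      then show "y \<in> W" unfolding W_def W'_def mem_Collect_eq inv .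
    qed
    show "\<phi> ` W \<subseteq> W'" unfolding W_def W'_def image_subset_iff mem_Collect_eq inv by blast
  qed
  have "x = ((0, 0), (fst (fst (snd x)), - (n * fst (fst (snd x)))), snd (snd x))" if "x \<in> W'" for x
  proof -
    obtain a b c d p q where x: "x = ((a, b), (c, d), (p, q))" by (metis surj_pair)
    have "b = 0" "a = 0" "g * (d + n * c) = 0"
      using that unfolding W'_def img x n by (simp_all add: algebra_simps)
    then have "d = - (n * c)" using g by (simp add: eq_neg_iff_add_eq_0)
    then show ?thesis using x \<open>a = 0\<close> \<open>b = 0\<close> by simp
  qed
  then have "bij_betw (\<lambda>(a, p, q). ((0, 0), (a, - (n * a)), (p, q))) UNIV W'"
    by (intro bij_betw_byWitness[where f' = "\<lambda>x. (fst (fst (snd x)), snd (snd x))"])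
       (auto simp: W'_def img n)
  then have bij: "bij_betw \<iota> UNIV W" unfolding \<iota>_def using W by (rule bij_betw_trans)
  have "lattice_isometry (orth_sum (Z_lattice (- 2 * n)) U_lattice) (U3\<lparr>elts := W\<rparr>) \<iota>"
    unfolding lattice_isometry_def
  proof (intro conjI ballI)
    show "bij_betw \<iota> (elts (orth_sum (Z_lattice (- 2 * n)) U_lattice)) (elts (U3\<lparr>elts := W\<rparr>))"
      using bij by (simp add: Z_lattice_def)
    fix x y :: "int \<times> int \<times> int"
    obtain a p q a' p' q' where xy: "x = (a, p, q)" "y = (a', p', q')" by (metis surj_pair)
    show "\<iota> (x + y) = \<iota> x + \<iota> y"
      using lattice_isometry_add[OF \<phi>i, of "((0, 0), (a, - (n * a)), (p, q))" "((0, 0), (a', - (n * a')), (p', q'))"]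
      by (simp add: xy \<iota>_def algebra_simps)
    show "pairing (U3\<lparr>elts := W\<rparr>) (\<iota> x) (\<iota> y) = pairing (orth_sum (Z_lattice (- 2 * n)) U_lattice) x y"
      using lattice_isometry_pairing[OF \<phi>i, of "((0, 0), (a, - (n * a)), (p, q))" "((0, 0), (a', - (n * a')), (p', q'))"]
      by (simp add: xy \<iota>_def Z_lattice_def algebra_simps)
  qed
  then show ?thesis using that[of n \<iota>] n0 unfolding W_def by blast
qed

section \<open>Alternating forms and oriented bases\<close>

lemma det_4:
  "det (A :: 'a::comm_ring_1 ^ 4 ^ 4) =
     A$1$1 * A$2$2 * A$3$3 * A$4$4 - A$1$1 * A$2$2 * A$3$4 * A$4$3
   - A$1$1 * A$2$3 * A$3$2 * A$4$4 + A$1$1 * A$2$3 * A$3$4 * A$4$2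
   + A$1$1 * A$2$4 * A$3$2 * A$4$3 - A$1$1 * A$2$4 * A$3$3 * A$4$2
   - A$1$2 * A$2$1 * A$3$3 * A$4$4 + A$1$2 * A$2$1 * A$3$4 * A$4$3
   + A$1$2 * A$2$3 * A$3$1 * A$4$4 - A$1$2 * A$2$3 * A$3$4 * A$4$1
   - A$1$2 * A$2$4 * A$3$1 * A$4$3 + A$1$2 * A$2$4 * A$3$3 * A$4$1
   + A$1$3 * A$2$1 * A$3$2 * A$4$4 - A$1$3 * A$2$1 * A$3$4 * A$4$2
   - A$1$3 * A$2$2 * A$3$1 * A$4$4 + A$1$3 * A$2$2 * A$3$4 * A$4$1
   + A$1$3 * A$2$4 * A$3$1 * A$4$2 - A$1$3 * A$2$4 * A$3$2 * A$4$1
   - A$1$4 * A$2$1 * A$3$2 * A$4$3 + A$1$4 * A$2$1 * A$3$3 * A$4$2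
   + A$1$4 * A$2$2 * A$3$1 * A$4$3 - A$1$4 * A$2$2 * A$3$3 * A$4$1
   - A$1$4 * A$2$3 * A$3$1 * A$4$2 + A$1$4 * A$2$3 * A$3$2 * A$4$1"
proof -
  have f1: "finite {4::4}" "1 \<notin> {4::4}" "2 \<notin> {4::4}" "3 \<notin> {4::4}"
    and f2: "finite {3::4, 4}" "1 \<notin> {3::4, 4}" "2 \<notin> {3::4, 4}"
    and f3: "finite {2::4, 3, 4}" "1 \<notin> {2::4, 3, 4}"
    by auto
  show ?thesis
    unfolding det_def UNIV_4
    unfolding sum_over_permutations_insert[OF f3]
    unfolding sum_over_permutations_insert[OF f2(1,3)]
    unfolding sum_over_permutations_insert[OF f1(1,4)]
    unfolding permutes_sing
    by (simp add: sign_swap_id permutation_swap_id permutation_compose sign_compose sign_id swap_id_eq algebra_simps)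
qed


section \<open>Wedge products of alternating forms under base change\<close>

definition alternating :: "form \<Rightarrow> bool" where
  "alternating E \<longleftrightarrow> (\<forall>x. ev E x x = 0)"

lemma alternating_self: "alternating E \<Longrightarrow> ev E x x = 0"
  by (simp add: alternating_def)

lemma alternating_swap: "alternating E \<Longrightarrow> ev E y x = - ev E x y"
  using alternating_self[of E "x + y"] alternating_self[of E x] alternating_self[of E y]
  by (simp add: blinfun.bilinear_simps)

lemma ev_sum_4:
  fixes c :: "(complex ^ 2) ^ 4"
  assumes E: "alternating E"
  shows "ev E (\<Sum>j\<in>UNIV. a j *\<^sub>R c $ j) (\<Sum>j\<in>UNIV. b j *\<^sub>R c $ j) =
     (a 1 * b 2 - a 2 * b 1) * ev E (c $ 1) (c $ 2) + (a 1 * b 3 - a 3 * b 1) * ev E (c $ 1) (c $ 3)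
   + (a 1 * b 4 - a 4 * b 1) * ev E (c $ 1) (c $ 4) + (a 2 * b 3 - a 3 * b 2) * ev E (c $ 2) (c $ 3)
   + (a 2 * b 4 - a 4 * b 2) * ev E (c $ 2) (c $ 4) + (a 3 * b 4 - a 4 * b 3) * ev E (c $ 3) (c $ 4)"
  by (simp add: sum_4 blinfun.bilinear_simps alternating_self[OF E] algebra_simps
      alternating_swap[OF E, of "c $ 2" "c $ 1"] alternating_swap[OF E, of "c $ 3" "c $ 1"]
      alternating_swap[OF E, of "c $ 4" "c $ 1"] alternating_swap[OF E, of "c $ 3" "c $ 2"]
      alternating_swap[OF E, of "c $ 4" "c $ 2"] alternating_swap[OF E, of "c $ 4" "c $ 3"])

text \<open>A 4-form on a space of dimension four scales by the determinant. Once both forms are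
  expanded in their six values on basis pairs, this is a polynomial identity.\<close>

lemma wedge_matrix:
  fixes c v :: "(complex ^ 2) ^ 4"
  assumes "alternating E" "alternating F"
    and v: "\<And>i. v $ i = (\<Sum>j\<in>UNIV. A $ i $ j *\<^sub>R c $ j)"
  shows "wedge E F (v $ 1) (v $ 2) (v $ 3) (v $ 4) = det A * wedge E F (c $ 1) (c $ 2) (c $ 3) (c $ 4)"
  unfolding v wedge_def ev_sum_4[OF assms(1)] ev_sum_4[OF assms(2)] det_4
  by algebra


section \<open>Real coordinates, dual bases and orientation\<close>

lemma real_coords_nth [simp]:
  "real_coords z $ 1 = Re (z $ 1)" "real_coords z $ 2 = Im (z $ 1)"
  "real_coords z $ 3 = Re (z $ 2)" "real_coords z $ 4 = Im (z $ 2)"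
  unfolding real_coords_def vector_def by simp_all

lemma linear_real_coords: "linear real_coords"
  by (rule linearI) (simp_all add: vec_eq_iff forall_4)

lemma real_coords_eq_iff: "real_coords x = real_coords y \<longleftrightarrow> x = y"
  by (auto simp: vec_eq_iff forall_4 forall_2 complex_eq_iff)

definition coord_matrix :: "(complex ^ 2) ^ 4 \<Rightarrow> real ^ 4 ^ 4" where
  "coord_matrix b = (\<chi> i. real_coords (b $ i))"

lemma coord_matrix_nth [simp]: "coord_matrix b $ i = real_coords (b $ i)"
  by (simp add: coord_matrix_def)

lemma coord_matrix_mult:
  assumes "\<And>i. v $ i = (\<Sum>j\<in>UNIV. A $ i $ j *\<^sub>R c $ j)"
  shows "coord_matrix v = A ** coord_matrix c"
proof -
  have "real_coords (v $ i) $ k = (\<Sum>j\<in>UNIV. A $ i $ j * real_coords (c $ j) $ k)" for i k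
    unfolding assms by (simp add: linear_sum[OF linear_real_coords] linear_scale[OF linear_real_coords])
  then show ?thesis by (simp add: vec_eq_iff matrix_matrix_mult_def)
qed

lemma oriented_basis_exists:
  assumes "period_lattice \<Lambda>"
  shows "\<exists>b. oriented_basis \<Lambda> b"
proof -
  obtain B where B: "independent B" "span B = (UNIV :: (complex ^ 2) set)" "zmod.span B = \<Lambda>"
    using assms unfolding period_lattice_def by blast
  have fin: "finite B" using B(1) by (rule finiteI_independent)
  have "card B = 4" using B(1,2) dim_eq_card[of B UNIV] by simp
  then obtain f where f: "bij_betw f (UNIV :: 4 set) B"
    using finite_same_card_bij[of "UNIV :: 4 set" B] fin by auto
  define b where "b = (\<chi> i. f i)"
  have range: "range (\<lambda>i. b $ i) = B" using f by (auto simp: b_def bij_betw_def)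
  have inj: "inj f" using f by (simp add: bij_betw_def)
  have det: "det (coord_matrix b) \<noteq> 0"
  proof -
    have "c i = 0" if "(\<Sum>i\<in>UNIV. c i *s row i (coord_matrix b)) = 0" for c i
    proof -
      have "real_coords (\<Sum>i\<in>UNIV. c i *\<^sub>R b $ i) = (\<Sum>i\<in>UNIV. c i *s row i (coord_matrix b))"
        by (simp add: linear_sum[OF linear_real_coords] linear_scale[OF linear_real_coords]
            row_def vec_lambda_eta scalar_mult_eq_scaleR)
      then have "(\<Sum>i\<in>UNIV. c i *\<^sub>R b $ i) = 0"
        using that real_coords_eq_iff linear_0[OF linear_real_coords] by metis
      then have "(\<Sum>v\<in>B. c (inv f v) *\<^sub>R v) = 0"
        using sum.reindex_bij_betw[OF f, of "\<lambda>v. c (inv f v) *\<^sub>R v"] inj by (simp add: b_def)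
      moreover have "f i \<in> B" using f by (auto simp: bij_betw_def)
      ultimately have "c (inv f (f i)) = 0"
        using independentD[OF B(1) fin subset_refl, of "\<lambda>v. c (inv f v)" "f i"] by simp
      then show ?thesis using inj by simp
    qed
    then have "\<exists>C. coord_matrix b ** C = mat 1"
      using matrix_right_invertible_independent_rows by blast
    then show ?thesis using invertible_det_nz invertible_right_inverse by blast
  qed
  show ?thesis
  proof (cases "det (coord_matrix b) > 0")
    case True
    then show ?thesis using range B(3) unfolding oriented_basis_def coord_matrix_def by blast
  next
    case False
    \<comment> \<open>Exchanging the first two vectors reverses the orientation and leaves the
      generated lattice unchanged.\<close>
    define b' where "b' = (\<chi> i. b $ (Transposition.transpose 1 2 i))"
    have "det (coord_matrix b') = - det (coord_matrix b)"
      by (simp add: det_4 b'_def Transposition.transpose_def)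
    then have "det (coord_matrix b') > 0" using det False by simp
    moreover have "range (\<lambda>i. b' $ i) = B"
    proof -
      have "range (\<lambda>i. b' $ i) = (\<lambda>i. b $ i) ` range (Transposition.transpose 1 2)"
        unfolding b'_def image_image by simp
      also have "range (Transposition.transpose 1 (2::4)) = UNIV"
        by (rule bij_is_surj) simp
      finally show ?thesis using range by simp
    qed
    ultimately show ?thesis using B(3) unfolding oriented_basis_def coord_matrix_def by metis
  qed
qed

lemma dual_basis:
  fixes b :: "(complex ^ 2) ^ 4"
  assumes "det (coord_matrix b) \<noteq> 0"
  obtains f :: "4 \<Rightarrow> (complex ^ 2) \<Rightarrow>\<^sub>L real"
  where "\<And>i j. f i (b $ j) = (if i = j then 1 else 0)"
    and "\<And>x. x = (\<Sum>i\<in>UNIV. f i x *\<^sub>R b $ i)"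
proof -
  obtain C where C: "coord_matrix b ** C = mat 1" "C ** coord_matrix b = mat 1"
    using assms invertible_det_nz unfolding invertible_def by blast
  define g where "g i x = (real_coords x v* C) $ i" for i x
  have "linear (g i)" for i
    unfolding g_def
    by (rule linearI) (simp_all add: vector_matrix_mult_def linear_add[OF linear_real_coords]
        linear_scale[OF linear_real_coords] sum.distrib sum_distrib_left algebra_simps)
  then have bl: "bounded_linear (g i)" for i by (simp add: linear_conv_bounded_linear)
  have 1: "g i (b $ j) = (if i = j then 1 else 0)" for i j
  proof -
    have "g i (b $ j) = (coord_matrix b ** C) $ j $ i"
      by (simp add: g_def vector_matrix_mult_def matrix_matrix_mult_def)
    then show ?thesis by (simp add: C mat_def)
  qed
  have 2: "x = (\<Sum>i\<in>UNIV. g i x *\<^sub>R b $ i)" for x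
  proof -
    have "real_coords (\<Sum>i\<in>UNIV. g i x *\<^sub>R b $ i) = (real_coords x v* C) v* coord_matrix b"
      by (simp add: g_def linear_sum[OF linear_real_coords] linear_scale[OF linear_real_coords]
          vec_eq_iff vector_matrix_mult_def[of _ "coord_matrix b"] mult.commute)
    also have "\<dots> = real_coords x" by (simp add: vector_matrix_mul_assoc C)
    finally show ?thesis by (simp add: real_coords_eq_iff)
  qed
  show ?thesis
    by (rule that[of "\<lambda>i. Blinfun (g i)"]) (use 1 2 in \<open>simp_all add: bounded_linear_Blinfun_apply[OF bl]\<close>)
qed

lemma span_range_dual_basis:
  fixes b :: "(complex ^ 2) ^ 4" and f :: "4 \<Rightarrow> (complex ^ 2) \<Rightarrow>\<^sub>L real"
  assumes f1: "\<And>i j. f i (b $ j) = (if i = j then 1 else 0)"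
    and f2: "\<And>x. x = (\<Sum>i\<in>UNIV. f i x *\<^sub>R b $ i)"
  shows "x \<in> zmod.span (range (\<lambda>i. b $ i)) \<longleftrightarrow> (\<forall>i. f i x \<in> \<int>)"
proof
  assume "x \<in> zmod.span (range (\<lambda>i. b $ i))"
  then show "\<forall>i. f i x \<in> \<int>"
    by (induction rule: zmod.span_induct_alt)
      (auto simp: zscale_def blinfun.bilinear_simps f1)
next
  assume "\<forall>i. f i x \<in> \<int>"
  then have "f i x *\<^sub>R b $ i = zscale \<lfloor>f i x\<rfloor> (b $ i)" for i
    by (simp add: zscale_def)
  then have "x = (\<Sum>i\<in>UNIV. zscale \<lfloor>f i x\<rfloor> (b $ i))"
    using f2[of x] by simp
  also have "\<dots> \<in> zmod.span (range (\<lambda>i. b $ i))"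
    by (intro zmod.span_sum zmod.span_scale zmod.span_base) auto
  finally show "x \<in> zmod.span (range (\<lambda>i. b $ i))" .
qed

section \<open>The intersection form does not depend on the basis\<close>

lemma oriented_basis_det_pos: "oriented_basis \<Lambda> b \<Longrightarrow> det (coord_matrix b) > 0"
  by (simp add: oriented_basis_def coord_matrix_def)

lemma oriented_basis_mem: "oriented_basis \<Lambda> b \<Longrightarrow> b $ i \<in> \<Lambda>"
  unfolding oriented_basis_def using zmod.span_base[of "b $ i" "range (\<lambda>i. b $ i)"] by auto

lemma oriented_basis_change:
  assumes b: "oriented_basis \<Lambda> b" and b': "oriented_basis \<Lambda> b'"
  obtains A where "\<And>i. b' $ i = (\<Sum>j\<in>UNIV. A $ i $ j *\<^sub>R b $ j)" "\<And>i j. A $ i $ j \<in> \<int>"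
proof -
  have "det (coord_matrix b) \<noteq> 0" using oriented_basis_det_pos[OF b] by simp
  then obtain f :: "4 \<Rightarrow> (complex ^ 2) \<Rightarrow>\<^sub>L real"
    where f: "\<And>i j. f i (b $ j) = (if i = j then 1 else 0)" "\<And>x. x = (\<Sum>i\<in>UNIV. f i x *\<^sub>R b $ i)"
    using dual_basis by blast
  define A where "A = (\<chi> i j. f j (b' $ i))"
  have "f j (b' $ i) \<in> \<int>" for i j
    using oriented_basis_mem[OF b', of i] span_range_dual_basis[OF f] b
    unfolding oriented_basis_def by blast
  then show ?thesis using that[of A] f(2) by (simp add: A_def)
qed

lemma det_4_Ints: "(\<And>i j. A $ i $ j \<in> \<int>) \<Longrightarrow> det (A :: real ^ 4 ^ 4) \<in> \<int>"
  unfolding det_4 by (intro Ints_add Ints_diff Ints_mult) auto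

lemma H2_alternating: "E \<in> H2 \<Lambda> \<Longrightarrow> alternating E"
  by (simp add: H2_def alternating_def)

text \<open>The base change matrices in both directions are integral, so the determinant is a unit
  of the integers; both bases are positive, so it is 1.\<close>

lemma wedge_oriented_basis_eq:
  assumes b: "oriented_basis \<Lambda> b" and b': "oriented_basis \<Lambda> b'"
    and EF: "alternating E" "alternating F"
  shows "wedge E F (b' $ 1) (b' $ 2) (b' $ 3) (b' $ 4) = wedge E F (b $ 1) (b $ 2) (b $ 3) (b $ 4)"
proof -
  obtain A where A: "\<And>i. b' $ i = (\<Sum>j\<in>UNIV. A $ i $ j *\<^sub>R b $ j)" "\<And>i j. A $ i $ j \<in> \<int>"
    using oriented_basis_change[OF b b'] by blast
  obtain A' where A': "\<And>i. b $ i = (\<Sum>j\<in>UNIV. A' $ i $ j *\<^sub>R b' $ j)" "\<And>i j. A' $ i $ j \<in> \<int>"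
    using oriented_basis_change[OF b' b] by blast
  have 1: "det (coord_matrix b') = det A * det (coord_matrix b)"
    unfolding coord_matrix_mult[OF A(1)] by (rule det_mul)
  have 2: "det (coord_matrix b) = det A' * det (coord_matrix b')"
    unfolding coord_matrix_mult[OF A'(1)] by (rule det_mul)
  note pos = oriented_basis_det_pos[OF b] oriented_basis_det_pos[OF b']
  obtain m n where mn: "det A = of_int m" "det A' = of_int n"
    using det_4_Ints[of A, OF A(2)] det_4_Ints[of A', OF A'(2)] by (metis Ints_cases)
  have "det A' * det A = 1" using 1 2 pos by (simp add: field_simps)
  then have "n * m = 1" using mn by (metis of_int_1 of_int_eq_iff of_int_mult)
  moreover have "det A > 0" using 1 pos by (metis zero_less_mult_pos2)
  ultimately have "m = 1" using mn zmult_eq_1_iff[of n m] by auto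
  then show ?thesis using wedge_matrix[OF EF, of b' A b] A(1) mn by simp
qed

text \<open>This resolves the definite description in \<open>cup\<close>: integrality gives a value,
  base change its uniqueness. Afterwards the form is always computed on one fixed basis.\<close>

lemma of_int_cup:
  assumes b: "oriented_basis \<Lambda> b" and E: "E \<in> H2 \<Lambda>" and F: "F \<in> H2 \<Lambda>"
  shows "of_int (cup \<Lambda> E F) = wedge E F (b $ 1) (b $ 2) (b $ 3) (b $ 4)"
proof -
  have "ev E (b $ i) (b $ j) \<in> \<int>" "ev F (b $ i) (b $ j) \<in> \<int>" for i j
    using E F oriented_basis_mem[OF b] by (auto simp: H2_def)
  then have "wedge E F (b $ 1) (b $ 2) (b $ 3) (b $ 4) \<in> \<int>"
    unfolding wedge_def by (intro Ints_add Ints_diff Ints_mult)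
  then obtain n where n: "of_int n = wedge E F (b $ 1) (b $ 2) (b $ 3) (b $ 4)"
    by (metis Ints_cases)
  have "cup \<Lambda> E F = n"
    unfolding cup_def
  proof (rule the_equality)
    show "\<exists>b. oriented_basis \<Lambda> b \<and> of_int n = wedge E F (b $ 1) (b $ 2) (b $ 3) (b $ 4)"
      using b n by blast
    show "n' = n" if n': "\<exists>b. oriented_basis \<Lambda> b \<and> of_int n' = wedge E F (b $ 1) (b $ 2) (b $ 3) (b $ 4)" for n'
    proof -
      obtain b' where "oriented_basis \<Lambda> b'" "of_int n' = wedge E F (b' $ 1) (b' $ 2) (b' $ 3) (b' $ 4)"
        using n' by blast
      then have "(of_int n' :: real) = of_int n"
        using wedge_oriented_basis_eq[OF b _ H2_alternating[OF E] H2_alternating[OF F]] n by metis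
      then show ?thesis by simp
    qed
  qed
  then show ?thesis using n by simp
qed

section \<open>The second cohomology as a sum of three hyperbolic planes\<close>

definition H2_lattice :: "(complex ^ 2) set \<Rightarrow> form zlattice" where
  "H2_lattice \<Lambda> = \<lparr>elts = H2 \<Lambda>, pairing = cup \<Lambda>\<rparr>"

lemma H2_lattice_simps [simp]: "elts (H2_lattice \<Lambda>) = H2 \<Lambda>" "pairing (H2_lattice \<Lambda>) = cup \<Lambda>"
  by (simp_all add: H2_lattice_def)

text \<open>The Pluecker coordinates of \<open>E\<close>, paired so that \<open>E \<and> E\<close> becomes the form of \<open>U \<oplus> U \<oplus> U\<close>; this is the
  reason for the sign of the coordinate with indices 1 and 3.\<close>

definition form_coords ::
    "(complex ^ 2) ^ 4 \<Rightarrow> form \<Rightarrow> (int \<times> int) \<times> (int \<times> int) \<times> (int \<times> int)" where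
  "form_coords b E =
     ((\<lfloor>ev E (b $ 1) (b $ 2)\<rfloor>, \<lfloor>ev E (b $ 3) (b $ 4)\<rfloor>),
      (\<lfloor>ev E (b $ 1) (b $ 4)\<rfloor>, \<lfloor>ev E (b $ 2) (b $ 3)\<rfloor>),
      (- \<lfloor>ev E (b $ 1) (b $ 3)\<rfloor>, \<lfloor>ev E (b $ 2) (b $ 4)\<rfloor>))"

definition covector_wedge ::
    "((complex ^ 2) \<Rightarrow>\<^sub>L real) \<Rightarrow> ((complex ^ 2) \<Rightarrow>\<^sub>L real) \<Rightarrow> form" where
  "covector_wedge f g = (blinfun_scaleR_left g o\<^sub>L f) - (blinfun_scaleR_left f o\<^sub>L g)"

lemma ev_covector_wedge [simp]: "ev (covector_wedge f g) x y = f x * g y - g x * f y"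
  by (simp add: covector_wedge_def blinfun.bilinear_simps)

text \<open>Six values on pairs of basis vectors determine an alternating form, and wedges of dual
  basis vectors realise any six integers.\<close>

lemma lattice_isometry_form_coords:
  assumes b: "oriented_basis \<Lambda> b"
  shows "lattice_isometry (H2_lattice \<Lambda>) U3 (form_coords b)"
proof -
  have "det (coord_matrix b) \<noteq> 0" using oriented_basis_det_pos[OF b] by simp
  then obtain f :: "4 \<Rightarrow> (complex ^ 2) \<Rightarrow>\<^sub>L real"
    where f: "\<And>i j. f i (b $ j) = (if i = j then 1 else 0)" "\<And>x. x = (\<Sum>i\<in>UNIV. f i x *\<^sub>R b $ i)"
    using dual_basis by blast
  have \<Lambda>: "x \<in> \<Lambda> \<longleftrightarrow> (\<forall>i. f i x \<in> \<int>)" for x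
    using span_range_dual_basis[OF f] b unfolding oriented_basis_def by blast
  have floor: "of_int \<lfloor>ev E (b $ i) (b $ j)\<rfloor> = ev E (b $ i) (b $ j)" if "E \<in> H2 \<Lambda>" for E i j
    using that oriented_basis_mem[OF b] by (auto simp: H2_def)
  \<comment> \<open>The inverse map; the minus sign in front of \<open>m13\<close> undoes the one in
    \<open>form_coords\<close>.\<close>
  define G where "G = (\<lambda>((a12, a34), (a14, a23), (m13, a24)).
      of_int a12 *\<^sub>R covector_wedge (f 1) (f 2) + of_int a34 *\<^sub>R covector_wedge (f 3) (f 4)
    + of_int a14 *\<^sub>R covector_wedge (f 1) (f 4) + of_int a23 *\<^sub>R covector_wedge (f 2) (f 3)
    - of_int m13 *\<^sub>R covector_wedge (f 1) (f 3) + of_int a24 *\<^sub>R covector_wedge (f 2) (f 4))"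
  have G: "G y \<in> H2 \<Lambda>" for y
  proof -
    have "ev (G y) x x' \<in> \<int>" if "x \<in> \<Lambda>" "x' \<in> \<Lambda>" for x x'
      using that unfolding \<Lambda> G_def
      by (auto simp: blinfun.bilinear_simps split: prod.splits intro!: Ints_add Ints_diff Ints_mult)
    then show ?thesis
      by (auto simp: H2_def G_def blinfun.bilinear_simps split: prod.splits)
  qed
  have FG: "form_coords b (G y) = y" for y
    by (auto simp: form_coords_def G_def blinfun.bilinear_simps f split: prod.splits)
  have inj: "E = F" if E: "E \<in> H2 \<Lambda>" and F: "F \<in> H2 \<Lambda>" and eq: "form_coords b E = form_coords b F" for E F
  proof -
    have e: "ev E (b $ 1) (b $ 2) = ev F (b $ 1) (b $ 2)" "ev E (b $ 3) (b $ 4) = ev F (b $ 3) (b $ 4)"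
      "ev E (b $ 1) (b $ 4) = ev F (b $ 1) (b $ 4)" "ev E (b $ 2) (b $ 3) = ev F (b $ 2) (b $ 3)"
      "ev E (b $ 1) (b $ 3) = ev F (b $ 1) (b $ 3)" "ev E (b $ 2) (b $ 4) = ev F (b $ 2) (b $ 4)"
      using eq floor[OF E] floor[OF F] unfolding form_coords_def prod.inject neg_equal_iff_equal
      by metis+
    have "ev E x y = ev F x y" for x y
    proof -
      have "ev E (\<Sum>i\<in>UNIV. f i x *\<^sub>R b $ i) (\<Sum>i\<in>UNIV. f i y *\<^sub>R b $ i)
        = ev F (\<Sum>i\<in>UNIV. f i x *\<^sub>R b $ i) (\<Sum>i\<in>UNIV. f i y *\<^sub>R b $ i)"
        unfolding ev_sum_4[OF H2_alternating[OF E]] ev_sum_4[OF H2_alternating[OF F]] e ..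
      then show ?thesis using f(2)[of x] f(2)[of y] by metis
    qed
    then show ?thesis by (intro blinfun_eqI) auto
  qed
  show ?thesis
    unfolding lattice_isometry_def
  proof (intro conjI ballI)
    have "form_coords b ` H2 \<Lambda> = UNIV" using G FG by (metis surj_def UNIV_eq_I imageI)
    then show "bij_betw (form_coords b) (elts (H2_lattice \<Lambda>)) (elts U3)"
      using inj by (simp add: bij_betw_def inj_on_def)
    fix E F assume "E \<in> elts (H2_lattice \<Lambda>)" "F \<in> elts (H2_lattice \<Lambda>)"
    then have E: "E \<in> H2 \<Lambda>" and F: "F \<in> H2 \<Lambda>" by simp_all
    have add: "\<lfloor>ev (E + F) (b $ i) (b $ j)\<rfloor> = \<lfloor>ev E (b $ i) (b $ j)\<rfloor> + \<lfloor>ev F (b $ i) (b $ j)\<rfloor>" for i j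
    proof -
      have "ev (E + F) (b $ i) (b $ j) = of_int (\<lfloor>ev E (b $ i) (b $ j)\<rfloor> + \<lfloor>ev F (b $ i) (b $ j)\<rfloor>)"
        unfolding of_int_add floor[OF E] floor[OF F] by (simp add: blinfun.bilinear_simps)
      then show ?thesis by (metis floor_of_int)
    qed
    show "form_coords b (E + F) = form_coords b E + form_coords b F"
      by (simp add: form_coords_def add)
    have "real_of_int (pairing U3 (form_coords b E) (form_coords b F)) = real_of_int (cup \<Lambda> E F)"
      unfolding of_int_cup[OF b E F]
      by (simp add: form_coords_def floor[OF E] floor[OF F] wedge_def del: of_int_floor_cancel)
    then show "pairing U3 (form_coords b E) (form_coords b F) = pairing (H2_lattice \<Lambda>) E F"
      by simp
  qed
qed

section \<open>Hodge index theorem and polarizations\<close>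

definition real_basis :: "(complex ^ 2) ^ 4" where
  "real_basis = (\<chi> i. if i = 1 then axis 1 1 else if i = 2 then axis 1 \<i> else if i = 3 then axis 2 1 else axis 2 \<i>)"

lemma real_basis_nth:
  "real_basis $ 1 = axis 1 1" "real_basis $ 2 = axis 1 \<i>"
  "real_basis $ 3 = axis 2 1" "real_basis $ 4 = axis 2 \<i>"
  by (simp_all add: real_basis_def)

lemma real_basis_expansion: "x = (\<Sum>j\<in>UNIV. real_coords x $ j *\<^sub>R real_basis $ j)"
  by (simp add: vec_eq_iff forall_2 sum_4 real_basis_nth axis_def complex_eq_iff)

lemma wedge_real_basis:
  assumes "alternating E" "alternating F"
  shows "wedge E F (b $ 1) (b $ 2) (b $ 3) (b $ 4) = det (coord_matrix b) *
    wedge E F (axis 1 1) (axis 1 \<i>) (axis 2 1) (axis 2 \<i>)"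
  using wedge_matrix[OF assms, of b "coord_matrix b" real_basis] real_basis_expansion[of "b $ _"]
  by (simp add: real_basis_nth)

section \<open>Classes of type (1,1) as Hermitian matrices\<close>

definition type11 :: "form \<Rightarrow> bool" where
  "type11 E \<longleftrightarrow> alternating E \<and> (\<forall>x y. ev E (\<i> *s x) (\<i> *s y) = ev E x y)"

text \<open>The entries of the Hermitian matrix of \<open>H(x, y) = E(\<i>x, y) + \<i>E(x, y)\<close>.\<close>

definition h11 :: "form \<Rightarrow> real" where "h11 E = ev E (axis 1 \<i>) (axis 1 1)"
definition h22 :: "form \<Rightarrow> real" where "h22 E = ev E (axis 2 \<i>) (axis 2 1)"
definition re_h12 :: "form \<Rightarrow> real" where "re_h12 E = ev E (axis 1 \<i>) (axis 2 1)"
definition im_h12 :: "form \<Rightarrow> real" where "im_h12 E = ev E (axis 1 1) (axis 2 1)"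

lemma i_times_axis: "\<i> *s axis k 1 = axis k \<i>" "\<i> *s axis k \<i> = - axis k (1 :: complex)"
  by (simp_all add: vec_eq_iff axis_def)

lemma type11_values:
  assumes E: "type11 E"
  shows "ev E (axis 1 1) (axis 1 \<i>) = - h11 E" "ev E (axis 2 1) (axis 2 \<i>) = - h22 E"
    "ev E (axis 1 1) (axis 2 1) = im_h12 E" "ev E (axis 1 \<i>) (axis 2 \<i>) = im_h12 E"
    "ev E (axis 1 1) (axis 2 \<i>) = - re_h12 E" "ev E (axis 1 \<i>) (axis 2 1) = re_h12 E"
proof -
  have alt: "alternating E" and inv: "ev E (\<i> *s x) (\<i> *s y) = ev E x y" for x y
    using E by (auto simp: type11_def)
  show "ev E (axis 1 1) (axis 1 \<i>) = - h11 E" "ev E (axis 2 1) (axis 2 \<i>) = - h22 E"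
    unfolding h11_def h22_def by (rule alternating_swap[OF alt])+
  show "ev E (axis 1 \<i>) (axis 2 \<i>) = im_h12 E"
    using inv[of "axis 1 1" "axis 2 1"] by (simp add: i_times_axis im_h12_def)
  show "ev E (axis 1 1) (axis 2 \<i>) = - re_h12 E"
    using inv[of "axis 1 1" "axis 2 \<i>"] by (simp add: i_times_axis re_h12_def blinfun.bilinear_simps)
qed (simp_all add: re_h12_def im_h12_def)

text \<open>On Hermitian matrices the intersection form is the polarisation of twice the
  determinant, a form of signature (1, 3); the Hodge index theorem rests on this.\<close>

lemma wedge_type11:
  assumes "type11 E" "type11 F"
  shows "wedge E F (axis 1 1) (axis 1 \<i>) (axis 2 1) (axis 2 \<i>) =
    h11 E * h22 F + h22 E * h11 F - 2 * (re_h12 E * re_h12 F) - 2 * (im_h12 E * im_h12 F)"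
  unfolding wedge_def type11_values[OF assms(1)] type11_values[OF assms(2)] by (simp add: algebra_simps)

lemma ev_type11:
  assumes "type11 E"
  shows "ev E x y =
      (Im (x $ 1) * Re (y $ 1) - Re (x $ 1) * Im (y $ 1)) * h11 E
    + (Im (x $ 2) * Re (y $ 2) - Re (x $ 2) * Im (y $ 2)) * h22 E
    + (Re (x $ 1) * Re (y $ 2) - Re (x $ 2) * Re (y $ 1) + Im (x $ 1) * Im (y $ 2) - Im (x $ 2) * Im (y $ 1)) * im_h12 E
    + (Im (x $ 1) * Re (y $ 2) - Re (x $ 2) * Im (y $ 1) - Re (x $ 1) * Im (y $ 2) + Im (x $ 2) * Re (y $ 1)) * re_h12 E"
proof -
  have alt: "alternating E" using assms by (simp add: type11_def)
  have "ev E x y = ev E (\<Sum>j\<in>UNIV. real_coords x $ j *\<^sub>R real_basis $ j) (\<Sum>j\<in>UNIV. real_coords y $ j *\<^sub>R real_basis $ j)"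
    using real_basis_expansion[of x] real_basis_expansion[of y] by simp
  then show ?thesis
    unfolding ev_sum_4[OF alt] unfolding real_basis_nth type11_values[OF assms] real_coords_nth
    by (simp add: algebra_simps)
qed

definition herm_det :: "form \<Rightarrow> real" where
  "herm_det E = h11 E * h22 E - (re_h12 E)\<^sup>2 - (im_h12 E)\<^sup>2"

text \<open>Completing the square: the first two squares form the squared modulus of one complex
  number, and the last term depends on the second coordinate only.\<close>

lemma h11_times_hermitian_form:
  assumes "type11 E"
  shows "h11 E * ev E (\<i> *s x) x =
      (h11 E * Re (x $ 1) + re_h12 E * Re (x $ 2) + im_h12 E * Im (x $ 2))\<^sup>2
    + (h11 E * Im (x $ 1) + re_h12 E * Im (x $ 2) - im_h12 E * Re (x $ 2))\<^sup>2
    + herm_det E * ((Re (x $ 2))\<^sup>2 + (Im (x $ 2))\<^sup>2)"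
  unfolding ev_type11[OF assms] herm_det_def by (simp add: power2_eq_square algebra_simps)

lemma positive_definite_iff:
  assumes E: "type11 E"
  shows "(\<forall>x. x \<noteq> 0 \<longrightarrow> ev E (\<i> *s x) x > 0) \<longleftrightarrow> h11 E > 0 \<and> herm_det E > 0"
proof
  assume pos: "\<forall>x. x \<noteq> 0 \<longrightarrow> ev E (\<i> *s x) x > 0"
  have "axis 1 1 \<noteq> (0 :: complex ^ 2)" by (simp add: axis_eq_0_iff)
  then have "ev E (\<i> *s axis 1 1) (axis 1 1) > 0" using pos by blast
  then have 1: "h11 E > 0" by (simp add: h11_def i_times_axis)
  \<comment> \<open>The first coordinate is chosen such that the two completed squares vanish and
    only the determinant term survives.\<close>
  define x :: "complex ^ 2" where "x = (\<chi> k. if k = 1 then Complex (- re_h12 E) (im_h12 E) else of_real (h11 E))"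
  have x: "x $ 1 = Complex (- re_h12 E) (im_h12 E)" "x $ 2 = of_real (h11 E)" by (simp_all add: x_def)
  have "x \<noteq> 0" using x(2) 1 by (metis less_irrefl of_real_eq_0_iff zero_index)
  then have "h11 E * ev E (\<i> *s x) x > 0" using pos 1 by simp
  also have "h11 E * ev E (\<i> *s x) x = herm_det E * (h11 E)\<^sup>2"
    unfolding h11_times_hermitian_form[OF E] x by (simp add: algebra_simps)
  finally show "h11 E > 0 \<and> herm_det E > 0" using 1 by (simp add: zero_less_mult_iff)
next
  assume pos: "h11 E > 0 \<and> herm_det E > 0"
  show "\<forall>x. x \<noteq> 0 \<longrightarrow> ev E (\<i> *s x) x > 0"
  proof (intro allI impI)
    fix x :: "complex ^ 2" assume x: "x \<noteq> 0"
    have "h11 E * ev E (\<i> *s x) x > 0"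
    proof (cases "x $ 2 = 0")
      case True
      then have "x $ 1 \<noteq> 0" using x by (auto simp: vec_eq_iff forall_2)
      then have "(Re (x $ 1))\<^sup>2 + (Im (x $ 1))\<^sup>2 > 0"
        by (simp add: complex_eq_iff sum_power2_gt_zero_iff)
      moreover have "h11 E * ev E (\<i> *s x) x = (h11 E)\<^sup>2 * ((Re (x $ 1))\<^sup>2 + (Im (x $ 1))\<^sup>2)"
        unfolding h11_times_hermitian_form[OF E] True by (simp add: power_mult_distrib distrib_left)
      ultimately show ?thesis using pos by simp
    next
      case False
      then have "(Re (x $ 2))\<^sup>2 + (Im (x $ 2))\<^sup>2 > 0"
        by (simp add: complex_eq_iff sum_power2_gt_zero_iff)
      then have "herm_det E * ((Re (x $ 2))\<^sup>2 + (Im (x $ 2))\<^sup>2) > 0" using pos by simp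
      then show ?thesis unfolding h11_times_hermitian_form[OF E]
        by (intro add_nonneg_pos add_nonneg_nonneg) auto
    qed
    then show "ev E (\<i> *s x) x > 0" using pos by (simp add: zero_less_mult_iff)
  qed
qed

section \<open>Positive classes and polarizations\<close>

lemma NS_type11: "E \<in> elts (NS \<Lambda>) \<Longrightarrow> type11 E"
  using H2_alternating by (auto simp: NS_def type11_def)

lemma NS_H2: "E \<in> elts (NS \<Lambda>) \<Longrightarrow> E \<in> H2 \<Lambda>"
  by (simp add: NS_def)

lemma NS_iff: "E \<in> elts (NS \<Lambda>) \<longleftrightarrow> E \<in> H2 \<Lambda> \<and> type11 E"
  using H2_alternating by (auto simp: NS_def type11_def)

lemma of_int_cup_NS:
  assumes "oriented_basis \<Lambda> b" "E \<in> elts (NS \<Lambda>)" "F \<in> elts (NS \<Lambda>)"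
  shows "of_int (cup \<Lambda> E F) = det (coord_matrix b) *
    (h11 E * h22 F + h22 E * h11 F - 2 * (re_h12 E * re_h12 F) - 2 * (im_h12 E * im_h12 F))"
  unfolding of_int_cup[OF assms(1) NS_H2[OF assms(2)] NS_H2[OF assms(3)]]
    wedge_real_basis[OF H2_alternating[OF NS_H2[OF assms(2)]] H2_alternating[OF NS_H2[OF assms(3)]]]
    wedge_type11[OF NS_type11[OF assms(2)] NS_type11[OF assms(3)]] ..

lemma cup_self_pos_iff:
  assumes b: "oriented_basis \<Lambda> b" and E: "E \<in> elts (NS \<Lambda>)"
  shows "cup \<Lambda> E E > 0 \<longleftrightarrow> herm_det E > 0"
proof -
  have "of_int (cup \<Lambda> E E) = (2 * det (coord_matrix b)) * herm_det E"
    unfolding of_int_cup_NS[OF b E E] herm_det_def by (simp add: power2_eq_square algebra_simps)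
  then show ?thesis
    using oriented_basis_det_pos[OF b] by (metis of_int_0_less_iff zero_less_mult_pos mult_pos_pos zero_less_numeral)
qed

lemma polarization_iff:
  assumes "oriented_basis \<Lambda> b" "E \<in> elts (NS \<Lambda>)"
  shows "polarization \<Lambda> E \<longleftrightarrow> h11 E > 0 \<and> cup \<Lambda> E E > 0"
  using assms positive_definite_iff[OF NS_type11[OF assms(2)]] cup_self_pos_iff[OF assms]
  by (simp add: polarization_def)

text \<open>Positive determinant makes a Hermitian matrix of size two definite, and the sign of its
  first diagonal entry decides between \<open>E\<close> and \<open>- E\<close>. That entry is
  nonzero, since otherwise the determinant would be at most 0.\<close>

lemma polarization_or_uminus:
  assumes b: "oriented_basis \<Lambda> b" and E: "E \<in> elts (NS \<Lambda>)" and pos: "cup \<Lambda> E E > 0"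
  shows "polarization \<Lambda> E \<or> polarization \<Lambda> (- E)"
proof -
  have E': "- E \<in> elts (NS \<Lambda>)"
    using E by (auto simp: NS_def H2_def blinfun.bilinear_simps)
  have h: "h11 (- E) = - h11 E" "herm_det (- E) = herm_det E"
    by (simp_all add: herm_det_def h11_def h22_def re_h12_def im_h12_def blinfun.bilinear_simps)
  have "herm_det E > 0" using cup_self_pos_iff[OF b E] pos by simp
  then have "h11 E \<noteq> 0" by (auto simp: herm_det_def) (smt (verit) zero_le_power2)
  then show ?thesis
    using polarization_iff[OF b E] polarization_iff[OF b E'] cup_self_pos_iff[OF b E] cup_self_pos_iff[OF b E'] pos h
    by (cases "h11 E > 0") auto
qed

text \<open>The reversed Cauchy-Schwarz inequality for the determinant of Hermitian matrices. The
  square of a d' - d a' and Lagrange's identity for (b, c) and (b', c') give (a d)(a' d') \<le> (b^2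
  + c^2)(a' d'), so a' d' \<le> 0, and every entry of the second matrix has to vanish.\<close>

lemma Hodge_index_real:
  fixes a b c d a' b' c' d' :: real
  assumes pos: "a > 0" "a * d - b\<^sup>2 - c\<^sup>2 > 0"
    and orth: "a * d' + d * a' = 2 * (b * b' + c * c')"
    and nonneg: "a' * d' - b'\<^sup>2 - c'\<^sup>2 \<ge> 0"
  shows "a' = 0 \<and> b' = 0 \<and> c' = 0 \<and> d' = 0"
proof -
  have "4 * (a * d) * (a' * d') \<le> (a * d' + d * a')\<^sup>2"
    using zero_le_power2[of "a * d' - d * a'"] by (simp add: power2_eq_square algebra_simps)
  also have "\<dots> = 4 * (b * b' + c * c')\<^sup>2" unfolding orth by (simp add: power2_eq_square algebra_simps)
  also have "\<dots> \<le> 4 * ((b\<^sup>2 + c\<^sup>2) * (b'\<^sup>2 + c'\<^sup>2))"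
    using zero_le_power2[of "b * c' - c * b'"] by (simp add: power2_eq_square algebra_simps)
  also have "\<dots> \<le> 4 * ((b\<^sup>2 + c\<^sup>2) * (a' * d'))"
    using nonneg by (intro mult_left_mono) auto
  finally have "(a * d - b\<^sup>2 - c\<^sup>2) * (a' * d') \<le> 0" by (simp add: algebra_simps)
  then have "a' * d' \<le> 0" using pos(2) by (simp add: mult_le_0_iff)
  then have "b'\<^sup>2 + c'\<^sup>2 \<le> 0" using nonneg by linarith
  then have bc: "b' = 0" "c' = 0" by (simp_all add: sum_power2_le_zero_iff)
  then have ad': "a' * d' = 0" using nonneg \<open>a' * d' \<le> 0\<close> by simp
  have ad: "a * d > 0" using pos(2) by (smt (verit) zero_le_power2)
  then have d: "d > 0" using pos(1) by (simp add: zero_less_mult_iff)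
  have "a * d' + d * a' = 0" using orth bc by simp
  then have "a' = 0 \<and> d' = 0" using ad' pos(1) d by auto
  then show ?thesis using bc by simp
qed

lemma Hodge_index:
  assumes b: "oriented_basis \<Lambda> b" and H: "polarization \<Lambda> H" and D: "D \<in> elts (NS \<Lambda>)"
    and orth: "cup \<Lambda> H D = 0" and "D \<noteq> 0"
  shows "cup \<Lambda> D D < 0"
proof (rule ccontr)
  assume "\<not> cup \<Lambda> D D < 0"
  then have "0 \<le> real_of_int (cup \<Lambda> D D)" by simp
  note pos = oriented_basis_det_pos[OF b]
  have HN: "H \<in> elts (NS \<Lambda>)" using H by (simp add: polarization_def)
  have "h11 H > 0" "herm_det H > 0"
    using H polarization_iff[OF b HN] cup_self_pos_iff[OF b HN] by auto
  moreover have "h11 H * h22 D + h22 H * h11 D = 2 * (re_h12 H * re_h12 D + im_h12 H * im_h12 D)"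
  proof -
    have "h11 H * h22 D + h22 H * h11 D - 2 * (re_h12 H * re_h12 D) - 2 * (im_h12 H * im_h12 D) = 0"
      using of_int_cup_NS[OF b HN D] orth pos by simp
    then show ?thesis by simp
  qed
  moreover have "h11 D * h22 D - (re_h12 D)\<^sup>2 - (im_h12 D)\<^sup>2 \<ge> 0"
  proof -
    have "0 \<le> h11 D * h22 D + h22 D * h11 D - 2 * (re_h12 D * re_h12 D) - 2 * (im_h12 D * im_h12 D)"
      using \<open>0 \<le> real_of_int (cup \<Lambda> D D)\<close> pos
      unfolding of_int_cup_NS[OF b D D] by (simp add: zero_le_mult_iff)
    then show ?thesis by (simp add: power2_eq_square)
  qed
  ultimately have "h11 D = 0 \<and> re_h12 D = 0 \<and> im_h12 D = 0 \<and> h22 D = 0"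
    unfolding herm_det_def by (intro Hodge_index_real)
  then have "ev D x y = 0" for x y
    unfolding ev_type11[OF NS_type11[OF D]] by simp
  then have "D = 0" by (intro blinfun_eqI) simp
  then show False using \<open>D \<noteq> 0\<close> by simp
qed

section \<open>Tori with prescribed Neron-Severi lattice\<close>

text \<open>An interval is uncountable, while the roots of nonzero integral polynomials form a
  countable set. Polynomials are given by coefficient lists so that each coefficient can be read off
  as zero.\<close>

lemma transcendental_between:
  fixes \<epsilon> :: real
  assumes "\<epsilon> > 0"
  obtains \<theta> where "0 < \<theta>" "\<theta> < \<epsilon>"
    "\<And>cs :: int list. poly (Poly (map real_of_int cs)) \<theta> = 0 \<Longrightarrow> Poly (map real_of_int cs) = 0"
proof -
  define P where "P = (\<lambda>cs. Poly (map real_of_int cs))"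
  have "countable (\<Union>cs\<in>{cs. P cs \<noteq> 0}. {x. poly (P cs) x = 0})"
    by (intro countable_UN) (auto intro: countable_finite poly_roots_finite)
  moreover have "uncountable {0<..<\<epsilon>}" using assms by (simp add: uncountable_open_interval)
  ultimately obtain \<theta> where "\<theta> \<in> {0<..<\<epsilon>}" "\<theta> \<notin> (\<Union>cs\<in>{cs. P cs \<noteq> 0}. {x. poly (P cs) x = 0})"
    by (meson countable_subset subsetI)
  then show ?thesis by (intro that) (auto simp: P_def)
qed

definition real_pairing :: "(real \<times> real) \<times> (real \<times> real) \<Rightarrow> (int \<times> int) \<times> (int \<times> int) \<Rightarrow> real" where
  "real_pairing = (\<lambda>((c, d), (p, q)) ((c', d'), (p', q')). c * d' + d * c' + (p * q' + q * p'))"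

text \<open>The vector is \<open>\<theta> l\<^sub>0 + \<theta>\<^sup>2 l\<^sub>1 + \<theta>\<^sup>3 l\<^sub>2\<close> for a small transcendental number \<open>\<theta>\<close>.\<close>


lemma generic_vector:
  assumes pos: "pairing U2 l\<^sub>0 l\<^sub>0 > 0"
  obtains c d p q :: real where "c * d + p * q > 0"
    "\<And>a b. of_int a + of_int b * (c * d + p * q) = 0 \<Longrightarrow> b = 0"
    "\<And>m. real_pairing ((c, d), (p, q)) m = 0 \<longleftrightarrow> m \<in> perp {l\<^sub>0, l\<^sub>1, l\<^sub>2}"
proof -
  obtain c0 d0 p0 q0 c1 d1 p1 q1 c2 d2 p2 q2 where
    l: "l\<^sub>0 = ((c0, d0), (p0, q0))" "l\<^sub>1 = ((c1, d1), (p1, q1))" "l\<^sub>2 = ((c2, d2), (p2, q2))"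
    by (metis surj_pair)
  \<comment> \<open>Each number is the coefficient of the corresponding power of \<theta> in half
    the square of the vector; the first is positive by hypothesis.\<close>
  define Q2 where "Q2 = c0 * d0 + p0 * q0"
  define Q3 where "Q3 = c0 * d1 + c1 * d0 + p0 * q1 + p1 * q0"
  define Q4 where "Q4 = c1 * d1 + p1 * q1 + (c0 * d2 + c2 * d0 + p0 * q2 + p2 * q0)"
  define Q5 where "Q5 = c1 * d2 + c2 * d1 + p1 * q2 + p2 * q1"
  define Q6 where "Q6 = c2 * d2 + p2 * q2"
  \<comment> \<open>With \<theta> (C + 1) < 1 the higher coefficients together contribute less than
    1, so they cannot outweigh \<open>Q2\<close>, which is an integer at least 1.\<close>
  define C where "C = real_of_int (\<bar>Q3\<bar> + \<bar>Q4\<bar> + \<bar>Q5\<bar> + \<bar>Q6\<bar>)"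
  have Q2: "Q2 \<ge> 1" using pos by (simp add: l Q2_def algebra_simps)
  have C: "C \<ge> 0" by (simp add: C_def)
  obtain \<theta> where \<theta>: "0 < \<theta>" "\<theta> < 1 / (C + 1)"
    "\<And>cs :: int list. poly (Poly (map real_of_int cs)) \<theta> = 0 \<Longrightarrow> Poly (map real_of_int cs) = 0"
    using transcendental_between[of "1 / (C + 1)"] C by auto
  \<comment> \<open>The powers start with \<theta> itself. Thus half the square has no constant
    term, and an integer cannot cancel an integral multiple of it.\<close>
  define c where "c = \<theta> * c0 + \<theta>^2 * c1 + \<theta>^3 * c2"
  define d where "d = \<theta> * d0 + \<theta>^2 * d1 + \<theta>^3 * d2"
  define p where "p = \<theta> * p0 + \<theta>^2 * p1 + \<theta>^3 * p2"
  define q where "q = \<theta> * q0 + \<theta>^2 * q1 + \<theta>^3 * q2"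
  have \<theta>1: "\<theta> * (C + 1) < 1" using \<theta>(2) C by (simp add: pos_less_divide_eq)
  have \<theta>2: "\<theta> \<le> 1" using \<theta>1 \<theta>(1) C by (smt (verit) mult_left_le mult_less_cancel_left2)
  have form: "c * d + p * q = \<theta>^2 * (Q2 + \<theta> * (Q3 + \<theta> * (Q4 + \<theta> * (Q5 + \<theta> * Q6))))"
    unfolding c_def d_def p_def q_def Q2_def Q3_def Q4_def Q5_def Q6_def of_int_add of_int_mult
    by algebra
  show ?thesis
  proof (rule that[of c d p q])
    have small: "\<bar>\<theta> * x\<bar> \<le> \<bar>x\<bar>" for x :: real
      using \<theta>(1) \<theta>2 by (simp add: abs_mult mult_left_le_one_le)
    have "\<bar>Q3 + \<theta> * (Q4 + \<theta> * (Q5 + \<theta> * Q6))\<bar> \<le> C"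
      using small[of "Q4 + \<theta> * (Q5 + \<theta> * Q6)"] small[of "Q5 + \<theta> * Q6"] small[of Q6]
      unfolding C_def of_int_add of_int_abs by linarith
    then have "\<bar>\<theta> * (Q3 + \<theta> * (Q4 + \<theta> * (Q5 + \<theta> * Q6)))\<bar> \<le> \<theta> * C"
      using \<theta>(1) by (simp add: abs_mult)
    also have "\<theta> * C < 1" using \<theta>1 \<theta>(1) by (simp add: distrib_left)
    finally have "Q2 + \<theta> * (Q3 + \<theta> * (Q4 + \<theta> * (Q5 + \<theta> * Q6))) > 0"
      using Q2 by linarith
    then show "c * d + p * q > 0" unfolding form using \<theta>(1) by simp
    show "b = 0" if "of_int a + of_int b * (c * d + p * q) = 0" for a b :: int
    proof -
      \<comment> \<open>The relation is an integral polynomial in \<theta>, written by ascending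
        coefficients; the coefficient of \<theta>^2 already forces b = 0.\<close>
      have "poly (Poly (map real_of_int [a, 0, b * Q2, b * Q3, b * Q4, b * Q5, b * Q6])) \<theta> = 0"
        using that unfolding form by (simp add: algebra_simps power2_eq_square)
      from \<theta>(3)[OF this] have "b * Q2 = 0" by simp
      then show ?thesis using Q2 by simp
    qed
    show "real_pairing ((c, d), (p, q)) m = 0 \<longleftrightarrow> m \<in> perp {l\<^sub>0, l\<^sub>1, l\<^sub>2}" for m
    proof -
      let ?B0 = "pairing U2 m l\<^sub>0" and ?B1 = "pairing U2 m l\<^sub>1" and ?B2 = "pairing U2 m l\<^sub>2"
      obtain c' d' p' q' where m: "m = ((c', d'), (p', q'))" by (metis surj_pair)
      \<comment> \<open>The three integral pairings become coefficients of distinct powers of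
        \<theta>, so one real equation is equivalent to all three conditions.\<close>
      have eq: "real_pairing ((c, d), (p, q)) m = poly (Poly (map real_of_int [0, ?B0, ?B1, ?B2])) \<theta>"
        by (simp add: real_pairing_def m l c_def d_def p_def q_def algebra_simps power2_eq_square power3_eq_cube)
      show ?thesis
      proof
        assume "real_pairing ((c, d), (p, q)) m = 0"
        then have "Poly (map real_of_int [0, ?B0, ?B1, ?B2]) = 0" unfolding eq by (rule \<theta>(3))
        then show "m \<in> perp {l\<^sub>0, l\<^sub>1, l\<^sub>2}" by (simp add: perp_def)
      next
        assume "m \<in> perp {l\<^sub>0, l\<^sub>1, l\<^sub>2}"
        then show "real_pairing ((c, d), (p, q)) m = 0" unfolding eq by (simp add: perp_def)
      qed
    qed
  qed
qed

section \<open>The torus attached to a period\<close>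

lemma period_lattice_of_basis:
  assumes "det (coord_matrix b) \<noteq> 0"
  shows "period_lattice (zmod.span (range (\<lambda>i. b $ i)))"
proof -
  obtain f :: "4 \<Rightarrow> (complex ^ 2) \<Rightarrow>\<^sub>L real" where f: "\<And>x. x = (\<Sum>i\<in>UNIV. f i x *\<^sub>R b $ i)"
    using dual_basis[OF assms] by metis
  have span: "span (range (\<lambda>i. b $ i)) = UNIV"
  proof (rule UNIV_eq_I[symmetric])
    fix x
    have "(\<Sum>i\<in>UNIV. f i x *\<^sub>R b $ i) \<in> span (range (\<lambda>i. b $ i))"
      by (intro span_sum span_scale span_base) auto
    then show "x \<in> span (range (\<lambda>i. b $ i))" using f[of x] by simp
  qed
  have "card (range (\<lambda>i. b $ i)) \<le> 4"
    using card_image_le[of "UNIV :: 4 set" "\<lambda>i. b $ i"] by simp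
  then have "independent (range (\<lambda>i. b $ i))"
    using card_le_dim_spanning[of "range (\<lambda>i. b $ i)" UNIV] span by simp
  then show ?thesis using span unfolding period_lattice_def by blast
qed

text \<open>The (2,0) part of a real form on a complex plane is a single complex number; its real
  and imaginary parts are the two equations.\<close>

lemma type11_iff:
  "type11 E \<longleftrightarrow> alternating E \<and> ev E (axis 1 \<i>) (axis 2 \<i>) = ev E (axis 1 1) (axis 2 1) \<and>
     ev E (axis 1 1) (axis 2 \<i>) = ev E (axis 2 1) (axis 1 \<i>)" (is "_ \<longleftrightarrow> ?R")
proof
  assume E: "type11 E"
  then have "alternating E" by (simp add: type11_def)
  then show ?R
    using type11_values[OF E] alternating_swap[of E "axis 2 1" "axis 1 \<i>"] by simp
next
  assume E: ?R
  then have alt: "alternating E" by simp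
  have E': "ev E (axis 1 \<i>) (axis 2 1) = - ev E (axis 1 1) (axis 2 \<i>)"
    using E alternating_swap[OF alt, of "axis 2 1" "axis 1 \<i>"] by simp
  have "ev E (\<i> *s x) (\<i> *s y) = ev E x y" for x y
  proof -
    have "ev E (\<Sum>j\<in>UNIV. real_coords (\<i> *s x) $ j *\<^sub>R real_basis $ j) (\<Sum>j\<in>UNIV. real_coords (\<i> *s y) $ j *\<^sub>R real_basis $ j)
      = ev E (\<Sum>j\<in>UNIV. real_coords x $ j *\<^sub>R real_basis $ j) (\<Sum>j\<in>UNIV. real_coords y $ j *\<^sub>R real_basis $ j)"
      unfolding ev_sum_4[OF alt] unfolding real_basis_nth real_coords_nth E'
      using E by (simp add: algebra_simps)
    then show ?thesis by (simp only: real_basis_expansion[symmetric])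
  qed
  then show "type11 E" using alt by (simp add: type11_def)
qed

text \<open>A torus whose period is built from a generic real vector orthogonal to exactly the
  wanted integral vectors. The vector \<open>k\<close> yields a class of positive square, so the
  torus is algebraic.\<close>

lemma abelian_surface_with_NS:
  assumes pos: "pairing U2 l\<^sub>0 l\<^sub>0 > 0"
    and k: "k \<in> perp {l\<^sub>0, l\<^sub>1, l\<^sub>2}" "pairing U2 k k > 0"
  obtains Y h where "abelian_surface Y" "lattice_isometry (H2_lattice Y) U3 h"
    "h ` elts (NS Y) = {0} \<times> perp {l\<^sub>0, l\<^sub>1, l\<^sub>2}"
proof -
  obtain c d p q :: real where w: "c * d + p * q > 0"
    "\<And>a b. of_int a + of_int b * (c * d + p * q) = 0 \<Longrightarrow> b = 0"
    "\<And>m. real_pairing ((c, d), (p, q)) m = 0 \<longleftrightarrow> m \<in> perp {l\<^sub>0, l\<^sub>1, l\<^sub>2}"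
    using generic_vector[OF pos] by blast
  \<comment> \<open>The last two vectors are i times the columns of the real matrix W with rows (d,
    q) and (p, - c). Its determinant is minus \<open>c * d + p * q\<close>, and its entries are
    arranged such that the second equation for type (1,1) is orthogonality to ((c, d), (p,
    q)).\<close>
  define b :: "(complex ^ 2) ^ 4" where
    "b = (\<chi> i. if i = 1 then axis 1 1 else if i = 2 then axis 2 1
      else if i = 3 then d *\<^sub>R axis 1 \<i> + p *\<^sub>R axis 2 \<i> else q *\<^sub>R axis 1 \<i> - c *\<^sub>R axis 2 \<i>)"
  have b: "b $ 1 = axis 1 1" "b $ 2 = axis 2 1"
    "b $ 3 = d *\<^sub>R axis 1 \<i> + p *\<^sub>R axis 2 \<i>" "b $ 4 = q *\<^sub>R axis 1 \<i> - c *\<^sub>R axis 2 \<i>"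
    by (simp_all add: b_def)
  have det: "det (coord_matrix b) = c * d + p * q"
    by (simp add: det_4 b axis_def)
  define Y where "Y = zmod.span (range (\<lambda>i. b $ i))"
  have Y: "period_lattice Y" unfolding Y_def using det w(1) by (intro period_lattice_of_basis) simp
  have ob: "oriented_basis Y b"
    using det w(1) by (simp add: oriented_basis_def Y_def coord_matrix_def)
  note h = lattice_isometry_form_coords[OF ob]
  have bij: "bij_betw (form_coords b) (H2 Y) UNIV"
    using h by (simp add: lattice_isometry_def)
  have NS: "E \<in> elts (NS Y) \<longleftrightarrow> form_coords b E \<in> {0} \<times> perp {l\<^sub>0, l\<^sub>1, l\<^sub>2}" if E: "E \<in> H2 Y" for E
  proof -
    note alt = H2_alternating[OF E]
    let ?D = "c * d + p * q"
    have int: "of_int \<lfloor>ev E (b $ i) (b $ j)\<rfloor> = ev E (b $ i) (b $ j)" for i j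
      using E oriented_basis_mem[OF ob] by (auto simp: H2_def)
    have 34: "ev E (b $ 3) (b $ 4) = - ?D * ev E (axis 1 \<i>) (axis 2 \<i>)"
      unfolding b by (simp add: blinfun.bilinear_simps alternating_self[OF alt]
          alternating_swap[OF alt, of "axis 2 \<i>" "axis 1 \<i>"] algebra_simps)
    have w_eq: "real_pairing ((c, d), (p, q)) (snd (form_coords b E)) =
      ?D * (ev E (axis 2 1) (axis 1 \<i>) - ev E (axis 1 1) (axis 2 \<i>))"
      unfolding form_coords_def real_pairing_def snd_conv case_prod_conv of_int_minus int
      unfolding b by (simp add: blinfun.bilinear_simps algebra_simps)
    have "E \<in> elts (NS Y) \<longleftrightarrow> type11 E" using E by (simp add: NS_iff)
    also have "\<dots> \<longleftrightarrow> ev E (b $ 3) (b $ 4) = - ?D * ev E (b $ 1) (b $ 2) \<and>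
        real_pairing ((c, d), (p, q)) (snd (form_coords b E)) = 0"
      unfolding type11_iff 34 w_eq using alt w(1) by (auto simp: b)
    \<comment> \<open>The first equation relates two integers by the factor \<open>- ?D\<close>;
      genericity leaves only the solution where both vanish, so the class has no component in the
      first plane.\<close>
    also have "ev E (b $ 3) (b $ 4) = - ?D * ev E (b $ 1) (b $ 2) \<longleftrightarrow> fst (form_coords b E) = 0"
    proof
      assume *: "ev E (b $ 3) (b $ 4) = - ?D * ev E (b $ 1) (b $ 2)"
      then have "of_int \<lfloor>ev E (b $ 3) (b $ 4)\<rfloor> + of_int \<lfloor>ev E (b $ 1) (b $ 2)\<rfloor> * ?D = 0"
        unfolding int by (simp add: algebra_simps)
      then have 0: "\<lfloor>ev E (b $ 1) (b $ 2)\<rfloor> = 0" by (rule w(2))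
      then have "ev E (b $ 1) (b $ 2) = 0" using int[of 1 2] by simp
      then have "ev E (b $ 3) (b $ 4) = 0" using * by simp
      then show "fst (form_coords b E) = 0" using 0 by (simp add: form_coords_def zero_prod_def)
    next
      assume "fst (form_coords b E) = 0"
      then have "\<lfloor>ev E (b $ 1) (b $ 2)\<rfloor> = 0" "\<lfloor>ev E (b $ 3) (b $ 4)\<rfloor> = 0"
        by (simp_all add: form_coords_def zero_prod_def)
      then show "ev E (b $ 3) (b $ 4) = - ?D * ev E (b $ 1) (b $ 2)"
        using int[of 1 2] int[of 3 4] by simp
    qed
    finally show ?thesis unfolding w(3) by (cases "form_coords b E") simp
  qed
  have img: "form_coords b ` elts (NS Y) = {0} \<times> perp {l\<^sub>0, l\<^sub>1, l\<^sub>2}"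
  proof (intro equalityI subsetI)
    fix y assume "y \<in> form_coords b ` elts (NS Y)"
    then show "y \<in> {0} \<times> perp {l\<^sub>0, l\<^sub>1, l\<^sub>2}" using NS NS_H2 by blast
  next
    fix y :: "(int \<times> int) \<times> (int \<times> int) \<times> (int \<times> int)"
    assume y: "y \<in> {0} \<times> perp {l\<^sub>0, l\<^sub>1, l\<^sub>2}"
    have "y \<in> form_coords b ` H2 Y" using bij by (simp add: bij_betw_def)
    then obtain E where E: "E \<in> H2 Y" "y = form_coords b E" by blast
    have "E \<in> elts (NS Y)" unfolding NS[OF E(1)] E(2)[symmetric] by (rule y)
    then show "y \<in> form_coords b ` elts (NS Y)" unfolding E(2) by (rule imageI)
  qed
  have "(0, k) \<in> form_coords b ` elts (NS Y)" unfolding img using k(1) by blast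
  then obtain E where E: "E \<in> elts (NS Y)" "form_coords b E = (0, k)" by auto
  have "cup Y E E = pairing U3 (0, k) (0, k)"
    using lattice_isometry_pairing[OF h, of E E] NS_H2[OF E(1)] E(2) by simp
  then have "cup Y E E > 0" using k(2) by (simp add: zero_prod_def)
  then have "abelian_surface Y"
    using polarization_or_uminus[OF ob E(1)] Y unfolding abelian_surface_def by blast
  then show ?thesis using h img that by blast
qed

section \<open>Mirror partners\<close>

lemma lattice_isometry_restrict:
  assumes f: "lattice_isometry L M f" and S: "S \<subseteq> elts L"
  shows "lattice_isometry (L\<lparr>elts := S\<rparr>) (M\<lparr>elts := f ` S\<rparr>) f"
proof -
  have "inj_on f S"
    using f S by (auto simp: lattice_isometry_def bij_betw_def intro: inj_on_subset)
  then have "bij_betw f S (f ` S)" by (simp add: bij_betw_def)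
  then show ?thesis
    using f S unfolding lattice_isometry_def by (simp add: subset_iff)
qed

lemma pairing_NS [simp]: "pairing (NS \<Lambda>) = cup \<Lambda>"
  by (simp add: NS_def)

lemma pairing_T_lattice [simp]: "pairing (T_lattice \<Lambda>) = cup \<Lambda>"
  by (simp add: T_lattice_def)

lemma elts_N_lattice [simp]: "elts (N_lattice \<Lambda>) = UNIV \<times> elts (NS \<Lambda>) \<times> UNIV"
  by (simp add: N_lattice_def)

lemma pairing_N_lattice [simp]:
  "pairing (N_lattice \<Lambda>) (r, D, s) (r', D', s') = cup \<Lambda> D D' - r * s' - s * r'"
  by (simp add: N_lattice_def)

lemma subspace_H2: "zmod.subspace (H2 \<Lambda>)"
  by (auto simp: zmod.subspace_def H2_def zscale_def blinfun.bilinear_simps)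

lemma subspace_NS: "zmod.subspace (elts (NS \<Lambda>))"
  using subspace_H2[of \<Lambda>] by (auto simp: zmod.subspace_def NS_def zscale_def blinfun.bilinear_simps)

lemma NS_divide:
  assumes "E \<in> H2 \<Lambda>" "zscale k E \<in> elts (NS \<Lambda>)" "k \<noteq> 0"
  shows "E \<in> elts (NS \<Lambda>)"
  using assms by (auto simp: NS_def zscale_def blinfun.bilinear_simps)

text \<open>A marking of the torus in the sense of period theory. It is kept abstract so that it may
  be composed with any isometry of the three planes.\<close>

locale H2_marking =
  fixes \<Lambda> :: "(complex ^ 2) set" and g :: "form \<Rightarrow> (int \<times> int) \<times> (int \<times> int) \<times> (int \<times> int)"
  assumes isometry: "lattice_isometry (H2_lattice \<Lambda>) U3 g"
begin

lemma bij: "bij_betw g (H2 \<Lambda>) UNIV"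
  using isometry by (simp add: lattice_isometry_def)

lemma add: "E \<in> H2 \<Lambda> \<Longrightarrow> F \<in> H2 \<Lambda> \<Longrightarrow> g (E + F) = g E + g F"
  using lattice_isometry_add[OF isometry, of E F] by simp

lemma cup: "E \<in> H2 \<Lambda> \<Longrightarrow> F \<in> H2 \<Lambda> \<Longrightarrow> pairing U3 (g E) (g F) = cup \<Lambda> E F"
  using lattice_isometry_pairing[OF isometry, of E F] by simp

lemma inj: "E \<in> H2 \<Lambda> \<Longrightarrow> F \<in> H2 \<Lambda> \<Longrightarrow> g E = g F \<Longrightarrow> E = F"
  using bij by (auto simp: bij_betw_def inj_on_def)

lemma surj: obtains E where "E \<in> H2 \<Lambda>" "g E = x"
proof -
  have "x \<in> g ` H2 \<Lambda>" using bij by (simp add: bij_betw_def)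
  then show ?thesis using that by blast
qed

lemma zero: "g 0 = 0"
  using add[of 0 0] zmod.subspace_0[OF subspace_H2] by simp

lemma scale: "E \<in> H2 \<Lambda> \<Longrightarrow> g (zscale k E) = smul3 k (g E)"
proof (induction k rule: int_induct[where k = 0])
  case (step1 k)
  then show ?case
    using add[OF zmod.subspace_scale[OF subspace_H2, of E \<Lambda> k], of E]
    by (simp add: zmod.scale_left_distrib smul3_add_1)
next
  case (step2 k)
  then show ?case
    using add[OF zmod.subspace_scale[OF subspace_H2, of E \<Lambda> "k - 1"], of E]
    by (simp add: zmod.scale_left_diff_distrib smul3_diff_1)
qed (simp add: zero smul3_0)

text \<open>Type (1,1) is a real linear condition, so an integral class with a nonzero multiple in
  NS lies in NS.\<close>

lemma saturated_NS: "saturated (g ` elts (NS \<Lambda>))"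
proof -
  have sum: "x + y \<in> g ` elts (NS \<Lambda>)" if xy: "x \<in> g ` elts (NS \<Lambda>)" "y \<in> g ` elts (NS \<Lambda>)" for x y
  proof -
    obtain D E where "x = g D" "y = g E" "D \<in> elts (NS \<Lambda>)" "E \<in> elts (NS \<Lambda>)" using xy by (elim imageE)
    then show ?thesis
      using imageI[OF zmod.subspace_add[OF subspace_NS, of D \<Lambda> E], of g] add NS_H2 by simp
  qed
  have mult: "smul3 k x \<in> g ` elts (NS \<Lambda>)" if x: "x \<in> g ` elts (NS \<Lambda>)" for k x
  proof -
    obtain D where "x = g D" "D \<in> elts (NS \<Lambda>)" using x by (elim imageE)
    then show ?thesis
      using imageI[OF zmod.subspace_scale[OF subspace_NS, of D \<Lambda> k], of g] scale NS_H2 by simp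
  qed
  have div: "x \<in> g ` elts (NS \<Lambda>)" if k: "k \<noteq> 0" "smul3 k x \<in> g ` elts (NS \<Lambda>)" for k x
  proof -
    obtain E where E: "E \<in> H2 \<Lambda>" "g E = x" using surj by blast
    obtain D where D: "D \<in> elts (NS \<Lambda>)" "smul3 k x = g D" using k(2) by (elim imageE)
    have "g (zscale k E) = g D" using scale[OF E(1)] E(2) D(2) by simp
    then have "zscale k E = D"
      using inj NS_H2[OF D(1)] zmod.subspace_scale[OF subspace_H2 E(1)] by blast
    then show ?thesis using NS_divide[OF E(1) _ k(1)] D(1) E(2) by blast
  qed
  show ?thesis
    unfolding saturated_def using div sum mult by (intro conjI ballI allI impI)
qed

lemma isometry_NS: "lattice_isometry (NS \<Lambda>) (U3\<lparr>elts := g ` elts (NS \<Lambda>)\<rparr>) g"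
proof -
  have "NS \<Lambda> = (H2_lattice \<Lambda>)\<lparr>elts := elts (NS \<Lambda>)\<rparr>" by (simp add: NS_def H2_lattice_def)
  moreover have "elts (NS \<Lambda>) \<subseteq> elts (H2_lattice \<Lambda>)" using NS_H2 by auto
  ultimately show ?thesis using lattice_isometry_restrict[OF isometry] by metis
qed

text \<open>If NS has no component in the first plane, orthogonality to NS does not constrain that
  plane, which therefore splits off from T.\<close>

lemma isometric_T_lattice:
  assumes S: "g ` elts (NS \<Lambda>) = {0} \<times> S"
  shows "isometric (T_lattice \<Lambda>) (orth_sum U_lattice (U2\<lparr>elts := perp S\<rparr>))"
proof -
  have T: "T_lattice \<Lambda> = (H2_lattice \<Lambda>)\<lparr>elts := elts (T_lattice \<Lambda>)\<rparr>"
    by (simp add: T_lattice_def H2_lattice_def)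
  have mem: "E \<in> elts (T_lattice \<Lambda>) \<longleftrightarrow> g E \<in> UNIV \<times> perp S" if E: "E \<in> H2 \<Lambda>" for E
  proof -
    obtain u x where x: "g E = (u, x)" by (metis surj_pair)
    have "E \<in> elts (T_lattice \<Lambda>) \<longleftrightarrow> (\<forall>y\<in>g ` elts (NS \<Lambda>). pairing U3 (g E) y = 0)"
      using E cup[OF E NS_H2] by (simp add: T_lattice_def)
    also have "\<dots> \<longleftrightarrow> (\<forall>y\<in>S. pairing U3 (u, x) (0, y) = 0)"
      unfolding S x by auto
    also have "\<dots> \<longleftrightarrow> g E \<in> UNIV \<times> perp S"
      by (cases u) (simp add: x perp_def zero_prod_def)
    finally show ?thesis .
  qed
  have img: "g ` elts (T_lattice \<Lambda>) = UNIV \<times> perp S"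
  proof (intro equalityI subsetI)
    fix y assume "y \<in> g ` elts (T_lattice \<Lambda>)"
    then obtain E where E: "E \<in> elts (T_lattice \<Lambda>)" "y = g E" by (elim imageE)
    then have "E \<in> H2 \<Lambda>" by (simp add: T_lattice_def)
    then show "y \<in> UNIV \<times> perp S" using mem E by blast
  next
    fix y :: "(int \<times> int) \<times> (int \<times> int) \<times> (int \<times> int)" assume y: "y \<in> UNIV \<times> perp S"
    obtain E where E: "E \<in> H2 \<Lambda>" "g E = y" using surj by blast
    then have "E \<in> elts (T_lattice \<Lambda>)" using mem[OF E(1)] y by simp
    then show "y \<in> g ` elts (T_lattice \<Lambda>)" using E(2) by blast
  qed
  have "elts (T_lattice \<Lambda>) \<subseteq> elts (H2_lattice \<Lambda>)" by (auto simp: T_lattice_def)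
  then have "lattice_isometry (T_lattice \<Lambda>) (U3\<lparr>elts := UNIV \<times> perp S\<rparr>) g"
    using lattice_isometry_restrict[OF isometry] T img by metis
  moreover have "U3\<lparr>elts := UNIV \<times> perp S\<rparr> = orth_sum U_lattice (U2\<lparr>elts := perp S\<rparr>)"
    by (simp add: U3_def orth_sum_def)
  ultimately show ?thesis unfolding isometric_def by metis
qed

lemma isometric_N_lattice:
  assumes S: "g ` elts (NS \<Lambda>) = {0} \<times> S"
  shows "isometric (N_lattice \<Lambda>) (orth_sum U_lattice (U2\<lparr>elts := S\<rparr>))"
proof -
  \<comment> \<open>The sign of \<open>s\<close> turns the Mukai pairing on H^0 and H^4 into the
    standard form of U.\<close>
  define f where "f = (\<lambda>(r :: int, D, s :: int). ((r, - s), snd (g D)))"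
  have g: "g D = ((0, 0), snd (g D))" "snd (g D) \<in> S" if D: "D \<in> elts (NS \<Lambda>)" for D
  proof -
    have "g D \<in> {0} \<times> S" using D S by blast
    then show "g D = ((0, 0), snd (g D))" "snd (g D) \<in> S" by (auto simp: zero_prod_def)
  qed
  have "lattice_isometry (N_lattice \<Lambda>) (orth_sum U_lattice (U2\<lparr>elts := S\<rparr>)) f"
    unfolding lattice_isometry_def
  proof (intro conjI ballI)
    show "bij_betw f (elts (N_lattice \<Lambda>)) (elts (orth_sum U_lattice (U2\<lparr>elts := S\<rparr>)))"
      unfolding bij_betw_def
    proof
      show "inj_on f (elts (N_lattice \<Lambda>))"
      proof (rule inj_onI)
        fix x y assume xy: "x \<in> elts (N_lattice \<Lambda>)" "y \<in> elts (N_lattice \<Lambda>)" "f x = f y"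
        obtain r D s r' D' s' where x: "x = (r, D, s)" and y: "y = (r', D', s')" by (metis surj_pair)
        have D: "D \<in> elts (NS \<Lambda>)" "D' \<in> elts (NS \<Lambda>)" using xy x y by auto
        have e: "r = r'" "s = s'" "snd (g D) = snd (g D')" using xy(3) by (auto simp: f_def x y)
        then have "g D = g D'" using g[OF D(1)] g[OF D(2)] by metis
        then have "D = D'" using inj D NS_H2 by blast
        then show "x = y" using x y e by simp
      qed
      show "f ` elts (N_lattice \<Lambda>) = elts (orth_sum U_lattice (U2\<lparr>elts := S\<rparr>))"
      proof (intro equalityI subsetI)
        fix y assume "y \<in> f ` elts (N_lattice \<Lambda>)"
        then show "y \<in> elts (orth_sum U_lattice (U2\<lparr>elts := S\<rparr>))" using g(2) by (auto simp: f_def)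
      next
        fix y :: "(int \<times> int) \<times> (int \<times> int) \<times> (int \<times> int)"
        assume y: "y \<in> elts (orth_sum U_lattice (U2\<lparr>elts := S\<rparr>))"
        obtain r s z where yz: "y = ((r, s), z)" by (metis surj_pair)
        then have "(0, z) \<in> g ` elts (NS \<Lambda>)" using y S by simp
        then obtain D where D: "(0, z) = g D" "D \<in> elts (NS \<Lambda>)" by (elim imageE)
        have "y = f (r, D, - s)" using D(1)[symmetric] by (simp add: f_def yz)
        moreover have "(r, D, - s) \<in> elts (N_lattice \<Lambda>)" using D(2) by simp
        ultimately show "y \<in> f ` elts (N_lattice \<Lambda>)" by (rule image_eqI)
      qed
    qed
    fix x y assume xy: "x \<in> elts (N_lattice \<Lambda>)" "y \<in> elts (N_lattice \<Lambda>)"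
    obtain r D s r' D' s' where x: "x = (r, D, s)" and y: "y = (r', D', s')" by (metis surj_pair)
    have D: "D \<in> elts (NS \<Lambda>)" "D' \<in> elts (NS \<Lambda>)" using xy x y by auto
    show "f (x + y) = f x + f y"
      using add[OF NS_H2[OF D(1)] NS_H2[OF D(2)]] by (simp add: f_def x y)
    have "cup \<Lambda> D D' = pairing U3 ((0, 0), snd (g D)) ((0, 0), snd (g D'))"
      using cup[OF NS_H2[OF D(1)] NS_H2[OF D(2)]] g(1)[OF D(1)] g(1)[OF D(2)] by metis
    then have "cup \<Lambda> D D' = pairing U2 (snd (g D)) (snd (g D'))" by simp
    then show "pairing (orth_sum U_lattice (U2\<lparr>elts := S\<rparr>)) (f x) (f y) = pairing (N_lattice \<Lambda>) x y"
      by (simp add: f_def x y)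
  qed
  then show ?thesis unfolding isometric_def by blast
qed

end

section \<open>Existence of a mirror partner\<close>

lemma N_lattice_add: "x \<in> elts (N_lattice \<Lambda>) \<Longrightarrow> y \<in> elts (N_lattice \<Lambda>) \<Longrightarrow> x + y \<in> elts (N_lattice \<Lambda>)"
  using zmod.subspace_add[OF subspace_NS] by auto

lemma T_lattice_add:
  assumes "H2_marking \<Lambda> g" "E \<in> elts (T_lattice \<Lambda>)" "F \<in> elts (T_lattice \<Lambda>)"
  shows "E + F \<in> elts (T_lattice \<Lambda>)"
proof -
  interpret H2_marking \<Lambda> g by fact
  have EF: "E \<in> H2 \<Lambda>" "F \<in> H2 \<Lambda>" using assms(2,3) by (auto simp: T_lattice_def)
  have "cup \<Lambda> (E + F) D = 0" if D: "D \<in> elts (NS \<Lambda>)" for D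
  proof -
    have dist: "pairing U3 (x + y) z = pairing U3 x z + pairing U3 y z" for x y z
      by (cases x; cases y; cases z) (auto simp: algebra_simps)
    have "cup \<Lambda> (E + F) D = cup \<Lambda> E D + cup \<Lambda> F D"
      using cup[OF zmod.subspace_add[OF subspace_H2 EF] NS_H2[OF D]] cup[OF EF(1) NS_H2[OF D]]
        cup[OF EF(2) NS_H2[OF D]] add[OF EF] dist by simp
    then show ?thesis using assms(2,3) D by (simp add: T_lattice_def)
  qed
  then show ?thesis using zmod.subspace_add[OF subspace_H2 EF] by (simp add: T_lattice_def)
qed

text \<open>Let K be the complement of the three vectors. NS(X) is the complement of K, and Y is
  chosen with NS(Y) equal to K. Then T(X) and N(Y) are both U + K, while N(X) and T(Y) are both U
  plus the complement of K.\<close>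

lemma mirror_partner_of_admissible:
  assumes g: "lattice_isometry (H2_lattice X) U3 g" and "admissible (g ` elts (NS X))"
  shows "\<exists>Y. abelian_surface Y \<and> mirror_partners X Y"
proof -
  obtain l\<^sub>0 l\<^sub>1 l\<^sub>2 k where l: "g ` elts (NS X) = {0} \<times> perp (perp {l\<^sub>0, l\<^sub>1, l\<^sub>2})"
    "pairing U2 l\<^sub>0 l\<^sub>0 > 0" "k \<in> perp {l\<^sub>0, l\<^sub>1, l\<^sub>2}" "pairing U2 k k > 0"
    using assms(2) unfolding admissible_def by blast
  obtain Y h where Y: "abelian_surface Y" and h: "lattice_isometry (H2_lattice Y) U3 h"
    and NSY: "h ` elts (NS Y) = {0} \<times> perp {l\<^sub>0, l\<^sub>1, l\<^sub>2}"
    using abelian_surface_with_NS[OF l(2-4)] by blast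
  interpret X: H2_marking X g by unfold_locales (rule g)
  interpret Y: H2_marking Y h by unfold_locales (rule h)
  have "isometric (T_lattice X) (N_lattice Y)"
  proof (rule isometric_trans)
    show "isometric (T_lattice X) (orth_sum U_lattice (U2\<lparr>elts := perp {l\<^sub>0, l\<^sub>1, l\<^sub>2}\<rparr>))"
      using X.isometric_T_lattice[OF l(1)] unfolding perp_perp_perp .
    show "isometric (orth_sum U_lattice (U2\<lparr>elts := perp {l\<^sub>0, l\<^sub>1, l\<^sub>2}\<rparr>)) (N_lattice Y)"
      by (rule isometric_sym[OF Y.isometric_N_lattice[OF NSY] N_lattice_add])
  qed
  moreover have "isometric (N_lattice X) (T_lattice Y)"
  proof (rule isometric_trans)
    show "isometric (N_lattice X) (orth_sum U_lattice (U2\<lparr>elts := perp (perp {l\<^sub>0, l\<^sub>1, l\<^sub>2})\<rparr>))"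
      by (rule X.isometric_N_lattice[OF l(1)])
    show "isometric (orth_sum U_lattice (U2\<lparr>elts := perp (perp {l\<^sub>0, l\<^sub>1, l\<^sub>2})\<rparr>)) (T_lattice Y)"
      by (rule isometric_sym[OF Y.isometric_T_lattice[OF NSY] T_lattice_add[OF Y.H2_marking_axioms]])
  qed
  ultimately show ?thesis using Y unfolding mirror_partners_def by blast
qed

definition U3_coord :: "(int \<times> int) \<times> (int \<times> int) \<times> (int \<times> int) \<Rightarrow> nat \<Rightarrow> int" where
  "U3_coord = (\<lambda>((a, b), (c, d), (p, q)) i. if i = 0 then a else if i = 1 then b else
     if i = 2 then c else if i = 3 then d else if i = 4 then p else q)"

lemma (in H2_marking) integral_coordinates_NS:
  "integral_coordinates (elts (NS \<Lambda>)) (\<lambda>E. U3_coord (g E)) 6"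
proof
  show "zmod.subspace (elts (NS \<Lambda>))" by (rule subspace_NS)
next
  fix E F i assume "E \<in> elts (NS \<Lambda>)" "F \<in> elts (NS \<Lambda>)"
  then have "g (E + F) = g E + g F" using add NS_H2 by blast
  then show "U3_coord (g (E + F)) i = U3_coord (g E) i + U3_coord (g F) i"
    by (auto simp: U3_coord_def split: prod.splits)
next
  fix E assume E: "E \<in> elts (NS \<Lambda>)" and 0: "\<And>i. i < 6 \<Longrightarrow> U3_coord (g E) i = 0"
  have "g E = g 0"
    using 0[of 0] 0[of 1] 0[of 2] 0[of 3] 0[of 4] 0[of 5]
    by (simp add: U3_coord_def zero zero_prod_def split: prod.splits)
  then show "E = 0" using inj NS_H2[OF E] zmod.subspace_0[OF subspace_H2] by blast
qed

text \<open>A polarization serves as the first generator: it has positive square, and its orthogonal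
  complement in NS(X) is negative definite by the Hodge index theorem.\<close>

lemma mirror_partner_of_rank_le_2:
  assumes X: "abelian_surface X" and rank: "picard_number X \<le> 2"
  shows "\<exists>Y. abelian_surface Y \<and> mirror_partners X Y"
proof -
  obtain b where b: "oriented_basis X b"
    using X oriented_basis_exists unfolding abelian_surface_def by blast
  obtain H where H: "polarization X H" using X unfolding abelian_surface_def by blast
  define g where "g = form_coords b"
  interpret H2_marking X g
    unfolding g_def by unfold_locales (rule lattice_isometry_form_coords[OF b])
  interpret coords: integral_coordinates "elts (NS X)"
"\<lambda>E. U3_coord (g E)" 6
    by (rule integral_coordinates_NS)
  have HN: "H \<in> elts (NS X)" using H by (simp add: polarization_def)
  have HH: "cup X H H > 0" using H polarization_iff[OF b HN] by simp
  then have "g H \<noteq> 0" using cup[OF NS_H2[OF HN] NS_H2[OF HN]] by (auto simp: zero_prod_def)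
  then have "H \<noteq> 0" using zero by auto
  then obtain D where D: "D \<in> elts (NS X)"
    and span: "\<And>E. E \<in> elts (NS X) \<Longrightarrow> \<exists>m a b. m \<noteq> 0 \<and> zscale m E = zscale a H + zscale b D"
    using coords.zrank_le_2D[OF rank[unfolded picard_number_def] HN] by blast
  obtain \<phi> where \<phi>: "lattice_isometry U3 U3 \<phi>" "admissible (\<phi> ` (g ` elts (NS X)))"
  proof (rule admissible_rank_two[of "g ` elts (NS X)" "g H" "g D"])
    show "saturated (g ` elts (NS X))" by (rule saturated_NS)
    show "g H \<in> g ` elts (NS X)" "g D \<in> g ` elts (NS X)" using HN D by blast+
    show "pairing U3 (g H) (g H) > 0" using cup[OF NS_H2[OF HN] NS_H2[OF HN]] HH by simp
    fix z assume z: "z \<in> g ` elts (NS X)"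
    then obtain E where E: "z = g E" "E \<in> elts (NS X)" by (elim imageE)
    show "\<exists>m a b. m \<noteq> 0 \<and> smul3 m z = smul3 a (g H) + smul3 b (g D)"
    proof -
      obtain m a b where m: "m \<noteq> 0" "zscale m E = zscale a H + zscale b D" using span[OF E(2)] by blast
      have "smul3 m (g E) = g (zscale m E)" using scale[OF NS_H2[OF E(2)]] by simp
      also have "\<dots> = smul3 a (g H) + smul3 b (g D)"
        unfolding m(2) using NS_H2[OF HN] NS_H2[OF D]
        by (simp add: add scale zmod.subspace_scale[OF subspace_H2])
      finally show ?thesis using m(1) E(1) by blast
    qed
    show "pairing U3 z z < 0" if "pairing U3 (g H) z = 0" "z \<noteq> 0"
    proof -
      have "E \<noteq> 0" using that(2) E(1) zero by auto
      moreover have "cup X H E = 0" using that(1) E cup[OF NS_H2[OF HN] NS_H2[OF E(2)]] by simp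
      ultimately have "cup X E E < 0" using Hodge_index[OF b H E(2)] by blast
      then show ?thesis using E cup[OF NS_H2[OF E(2)] NS_H2[OF E(2)]] by simp
    qed
  qed
  show ?thesis
    by (rule mirror_partner_of_admissible[of X "\<phi> \<circ> g"])
       (use \<phi> lattice_isometry_comp[OF isometry \<phi>(1)] in \<open>simp_all add: image_comp\<close>)
qed

lemma mirror_partner_of_rank_3:
  assumes X: "abelian_surface X" and n: "n > 0"
    and iso: "isometric (NS X) (orth_sum (Z_lattice (- 2 * n)) U_lattice)"
  shows "\<exists>Y. abelian_surface Y \<and> mirror_partners X Y"
proof -
  obtain b where b: "oriented_basis X b"
    using X oriented_basis_exists unfolding abelian_surface_def by blast
  define g where "g = form_coords b"
  interpret H2_marking X g
    unfolding g_def by unfold_locales (rule lattice_isometry_form_coords[OF b])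
  have "isometric (orth_sum (Z_lattice (- 2 * n)) U_lattice) (NS X)"
    by (rule isometric_sym[OF iso zmod.subspace_add[OF subspace_NS]])
  then obtain f where f: "lattice_isometry (orth_sum (Z_lattice (- 2 * n)) U_lattice) (NS X) f"
    unfolding isometric_def by blast
  obtain \<phi> where \<phi>: "lattice_isometry U3 U3 \<phi>" "admissible (\<phi> ` (g ` elts (NS X)))"
    using admissible_rank_three[OF saturated_NS n lattice_isometry_comp[OF f isometry_NS]] by blast
  show ?thesis
    by (rule mirror_partner_of_admissible[of X "\<phi> \<circ> g"])
       (use \<phi> lattice_isometry_comp[OF isometry \<phi>(1)] in \<open>simp_all add: image_comp\<close>)
qed

text \<open>NS(X) is orthogonal to T(X), in which H^0 and H^4 of Y form a hyperbolic pair and a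
  polarization of Y a positive vector orthogonal to it. So NS(X) lies in a lattice of rank 3 of the
  shape wanted.\<close>

lemma rank_of_mirror_partner:
  assumes X: "abelian_surface X" and Y: "abelian_surface Y" and iso: "isometric (T_lattice X) (N_lattice Y)"
  shows "picard_number X \<le> 3"
    and "picard_number X = 3 \<Longrightarrow>
      \<exists>n::int. n > 0 \<and> isometric (NS X) (orth_sum (Z_lattice (- 2 * n)) U_lattice)"
proof -
  obtain b where b: "oriented_basis X b"
    using X oriented_basis_exists unfolding abelian_surface_def by blast
  obtain b' where b': "oriented_basis Y b'"
    using Y oriented_basis_exists unfolding abelian_surface_def by blast
  obtain H where H: "polarization Y H" using Y unfolding abelian_surface_def by blast
  have HN: "H \<in> elts (NS Y)" using H by (simp add: polarization_def)
  have HH: "cup Y H H > 0" using H polarization_iff[OF b' HN] by simp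
  have N0: "0 \<in> elts (NS Y)" by (rule zmod.subspace_0[OF subspace_NS])
  have cup0: "cup Y 0 E = 0" "cup Y E 0 = 0" if "E \<in> elts (NS Y)" for E
  proof -
    have "real_of_int (cup Y 0 E) = 0" "real_of_int (cup Y E 0) = 0"
      unfolding of_int_cup[OF b' NS_H2[OF N0] NS_H2[OF that]] of_int_cup[OF b' NS_H2[OF that] NS_H2[OF N0]]
      by (simp_all add: wedge_def)
    then show "cup Y 0 E = 0" "cup Y E 0 = 0" by simp_all
  qed
  define g where "g = form_coords b"
  interpret H2_marking X g
    unfolding g_def by unfold_locales (rule lattice_isometry_form_coords[OF b])
  have "isometric (N_lattice Y) (T_lattice X)"
    by (rule isometric_sym[OF iso T_lattice_add[OF H2_marking_axioms]])
  then obtain f where f: "lattice_isometry (N_lattice Y) (T_lattice X) f"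
    unfolding isometric_def by blast
  have fT: "f x \<in> elts (T_lattice X)" if "x \<in> elts (N_lattice Y)" for x
    using f that by (auto simp: lattice_isometry_def bij_betw_def)
  then have fH2: "f x \<in> H2 X" if "x \<in> elts (N_lattice Y)" for x
    using that by (auto simp: T_lattice_def)
  have gf: "pairing U3 (g (f x)) (g (f y)) = pairing (N_lattice Y) x y"
    if "x \<in> elts (N_lattice Y)" "y \<in> elts (N_lattice Y)" for x y
    using cup[OF fH2[OF that(1)] fH2[OF that(2)]] lattice_isometry_pairing[OF f that] by simp
  define e where "e = g (f (1, 0, 0))"
  \<comment> \<open>The generator of H^4 enters with the sign - 1, since the Mukai pairing of H^0
    and H^4 is negative.\<close>
  define e' where "e' = g (f (0, 0, - 1))"
  define v where "v = g (f (0, H, 0))"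
  have mem: "(1, 0, 0) \<in> elts (N_lattice Y)" "(0, 0, - 1) \<in> elts (N_lattice Y)" "(0, H, 0) \<in> elts (N_lattice Y)"
    using N0 HN by simp_all
  have pairings: "pairing U3 e e = 0" "pairing U3 e' e' = 0" "pairing U3 e e' = 1"
    "pairing U3 e v = 0" "pairing U3 e' v = 0" "pairing U3 v v > 0"
    unfolding e_def e'_def v_def using gf mem cup0[OF N0] cup0[OF HN] HH by simp_all
  define W where "W = {x. pairing U3 e x = 0 \<and> pairing U3 e' x = 0 \<and> pairing U3 v x = 0}"
  obtain n \<iota> where n: "n > 0" and \<iota>: "lattice_isometry (orth_sum (Z_lattice (- 2 * n)) U_lattice) (U3\<lparr>elts := W\<rparr>) \<iota>"
    using orthogonal_complement_of_U_plus_vector[OF pairings] unfolding W_def by blast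
  have NSW: "g D \<in> W" if D: "D \<in> elts (NS X)" for D
  proof -
    have "pairing U3 (g (f x)) (g D) = 0" if "x \<in> elts (N_lattice Y)" for x
      using cup[OF fH2[OF that] NS_H2[OF D]] fT[OF that] D by (simp add: T_lattice_def)
    then show ?thesis unfolding W_def e_def e'_def v_def using mem by blast
  qed
  define M where "M = orth_sum (Z_lattice (- 2 * n)) U_lattice"
  have M: "elts M = UNIV" by (simp add: M_def Z_lattice_def)
  note \<iota> = \<iota>[folded M_def]
  define j where "j = inv_into (elts M) \<iota>"
  have j: "lattice_isometry (U3\<lparr>elts := W\<rparr>) M j"
    unfolding j_def by (rule lattice_isometry_inv_into[OF \<iota>]) (simp add: M)
  have \<iota>j: "\<iota> (j x) = x" if "x \<in> W" for x
    using \<iota> that unfolding j_def lattice_isometry_def bij_betw_def by (simp add: f_inv_into_f)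
  have j\<iota>: "\<iota> x \<in> W" for x
    using \<iota> M unfolding lattice_isometry_def bij_betw_def by auto
  have \<iota>_add: "\<iota> (x + y) = \<iota> x + \<iota> y" for x y
    using lattice_isometry_add[OF \<iota>, of x y] M by simp
  have \<iota>_scale: "\<iota> (m * a, m * p, m * q) = smul3 m (\<iota> (a, p, q))" for m a p q
  proof (induction m rule: int_induct[where k = 0])
    case base
    show ?case using \<iota>_add[of 0 0] by (simp add: smul3_0 zero_prod_def)
  next
    case (step1 m)
    then show ?case using \<iota>_add[of "(m * a, m * p, m * q)" "(a, p, q)"]
      by (simp add: smul3_add_1 distrib_right)
  next
    case (step2 m)
    then show ?case using \<iota>_add[of "((m - 1) * a, (m - 1) * p, (m - 1) * q)" "(a, p, q)"]
      by (simp add: smul3_diff_1 left_diff_distrib)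
  qed
  \<comment> \<open>Coordinates in the sum of Z(-2n) and U, transported by the identification of
    \<open>W\<close> with it; three of them suffice, whence the bound on the Picard number.\<close>
  define \<kappa> where "\<kappa> E i = (case j (g E) of (a, p, q) \<Rightarrow> if i = 0 then a else if i = 1 then p else q)"
    for E and i :: nat
  interpret coords: integral_coordinates "elts (NS X)" \<kappa> 3
  proof
    show "zmod.subspace (elts (NS X))" by (rule subspace_NS)
  next
    fix D E i assume D: "D \<in> elts (NS X)" and E: "E \<in> elts (NS X)"
    have "j (g (D + E)) = j (g D) + j (g E)"
      using lattice_isometry_add[OF j, of "g D" "g E"] add[OF NS_H2[OF D] NS_H2[OF E]] NSW[OF D] NSW[OF E] by simp
    then show "\<kappa> (D + E) i = \<kappa> D i + \<kappa> E i"
      by (simp add: \<kappa>_def split: prod.splits)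
  next
    fix D assume D: "D \<in> elts (NS X)" and 0: "\<And>i. i < 3 \<Longrightarrow> \<kappa> D i = 0"
    have "j (g D) = (0, 0, 0)"
      using 0[of 0] 0[of 1] 0[of 2] by (simp add: \<kappa>_def split: prod.splits)
    then have "g D = 0"
      using \<iota>j[OF NSW[OF D]] \<iota>_add[of 0 0] by (simp add: zero_prod_def)
    then show "D = 0"
      using inj[OF NS_H2[OF D] zmod.subspace_0[OF subspace_H2]] zero by simp
  qed
  show "picard_number X \<le> 3" unfolding picard_number_def by (rule coords.zrank_le)
  show "\<exists>n::int. n > 0 \<and> isometric (NS X) (orth_sum (Z_lattice (- 2 * n)) U_lattice)"
    if rank: "picard_number X = 3"
  proof -
    \<comment> \<open>In rank 3 some nonzero multiple of \<open>w\<close> belongs to the image of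
      NS(X); saturation gives \<open>w\<close> itself.\<close>
    have "w \<in> g ` elts (NS X)" if w: "w \<in> W" for w
    proof -
      obtain a p q where apq: "j w = (a, p, q)" by (metis surj_pair)
      obtain m D where D: "m \<noteq> 0" "D \<in> elts (NS X)"
        "\<And>i. i < 3 \<Longrightarrow> \<kappa> D i = m * (if i = 0 then a else if i = 1 then p else q)"
        using coords.full_rank[OF rank[unfolded picard_number_def],
            of "\<lambda>i. if i = 0 then a else if i = 1 then p else q"] by blast
      have "j (g D) = (m * a, m * p, m * q)"
        using D(3)[of 0] D(3)[of 1] D(3)[of 2] by (simp add: \<kappa>_def split: prod.splits)
      then have "g D = smul3 m w"
        using \<iota>j[OF NSW[OF D(2)]] \<iota>j[OF w] \<iota>_scale[of m a p q] apq by simp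
      then have "smul3 m w \<in> g ` elts (NS X)" using D(2) by (metis imageI)
      then show ?thesis using saturated_divide[OF saturated_NS _ D(1)] by blast
    qed
    then have "g ` elts (NS X) = W" using NSW by blast
    then have "lattice_isometry (NS X) M (j \<circ> g)"
      using lattice_isometry_comp[OF isometry_NS] j by metis
    then show ?thesis using n unfolding isometric_def M_def by blast
  qed
qed

theorem theorem1p6:
  fixes X :: "(complex ^ 2) set"
  assumes "abelian_surface X"
  shows "(\<exists>Y. abelian_surface Y \<and> mirror_partners X Y) \<longleftrightarrow>
    picard_number X \<le> 2 \<or>
    (picard_number X = 3 \<and>
      (\<exists>n::int. n > 0 \<and> isometric (NS X) (orth_sum (Z_lattice (- 2 * n)) U_lattice)))"
proof
  assume "\<exists>Y. abelian_surface Y \<and> mirror_partners X Y"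
  then obtain Y where "abelian_surface Y" "isometric (T_lattice X) (N_lattice Y)"
    unfolding mirror_partners_def by blast
  note rank = rank_of_mirror_partner[OF assms this]
  show "picard_number X \<le> 2 \<or> (picard_number X = 3 \<and>
      (\<exists>n::int. n > 0 \<and> isometric (NS X) (orth_sum (Z_lattice (- 2 * n)) U_lattice)))"
  proof (cases "picard_number X = 3")
    case True
    then show ?thesis using rank(2) by blast
  next
    case False
    then show ?thesis using rank(1) by simp
  qed
next
  assume "picard_number X \<le> 2 \<or> (picard_number X = 3 \<and>
      (\<exists>n::int. n > 0 \<and> isometric (NS X) (orth_sum (Z_lattice (- 2 * n)) U_lattice)))"
  then show "\<exists>Y. abelian_surface Y \<and> mirror_partners X Y"
    using mirror_partner_of_rank_le_2[OF assms] mirror_partner_of_rank_3[OF assms] by blast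
qed

end
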